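(* Let $\mathcal{E}=\{E_0=I,E_1,\ldots,E_m\}\subset\mathcal{P}_n$ be a maximal correctable error set, and let $\mathcal{A}_R$ be the unital $*$-algebra of operators on $\mathcal{H}_{\rm kin}$ generated by $\{E_i\Pi_{\rm pn}\}_{i=0}^m$. Then: (i) $\mathcal{A}_R$ is independent of the representative of the equivalence class $[\mathcal{E}]$, i.e. the unital $*$-algebra generated by $\{E'\Pi_{\rm pn}: E'\in\mathcal{E}'\}$ equals $\mathcal{A}_R$ for every correctable error set $\mathcal{E}'$ equivalent to $\mathcal{E}$; (ii) $\mathcal{G}\subset\mathcal{A}_R$; (iii) there is a Hilbert space $\mathcal{H}_R\simeq(\mathbb{C}^2)^{\otimes(n-k)}$ with $\mathcal{A}_R=\mathcal{B}(\mathcal{H}_R)$; more precisely, $\mathcal{A}_R$ and its commutant $\mathcal{A}_S:=\mathcal{A}_R'$ (a $k$-qubit algebra of gauge-invariant operators) define a tensor product structure $\mathcal{H}_{\rm kin}\simeq\mathcal{H}_R\otimes\mathcal{H}_S$, $\mathcal{H}_S\simeq(\mathbb{C}^2)^{\otimes k}$, with $\mathcal{A}_R=\mathcal{B}(\mathcal{H}_R)\otimes I_S$, $\mathcal{A}_S=I_R\otimes\mathcal{B}(\mathcal{H}_S)$, in which $U^g=U^g_R\otimes I_S$ for all $g\in G$. Furthermore $\mathcal{H}_R$ admits an orthonormal basis $\{\ket{g}_R\}_{g\in G}$ of orientation states, $U^g_R\ket{h}_R=c(g,h)\ket{gh}_R$ with $|c(g,h)|=1$ (i.e. $R$ is an ideal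 QRF). Conversely, let $\mathcal{H}_{\rm kin}\simeq\mathcal{H}_R\otimes\mathcal{H}_S$ with $\mathcal{H}_R\simeq(\mathbb{C}^2)^{\otimes(n-k)}$ be a tensor factorization such that $U^g=U^g_R\otimes I_S$ for all $g\in G$ with $g\mapsto U^g_R$ faithful. Then there is a unique equivalence class $[\hat{\mathcal{E}}]$ of maximal correctable error sets whose elements $\hat E$ all satisfy $\hat E\Pi_{\rm pn}=e_R\otimes I_S$ for some $e_R\in\mathcal{B}(\mathcal{H}_R)$; this class contains the set $\{\hat U^\chi_R\otimes I_S\}_{\chi\in\hat G}$ for every unitary representation $\hat U_R$ of $\hat G$ on $\mathcal{H}_R$ that is dual to $U_R$.
   Context: Let $n\ge1$, $0\le k<n$ be integers, $\mathcal{H}_{\rm kin}=(\mathbb{C}^2)^{\otimes n}$, and $\mathcal{P}_n$ the $n$-qubit Pauli group (all operators $i^\lambda O_1\otimes\cdots\otimes O_n$, $\lambda\in\{0,1,2,3\}$, $O_j\in\{I,X,Y,Z\}$). Let $G=\mathbb{Z}_2^{\times(n-k)}$ and $U:G\to\mathcal{P}_n$, $g\mapsto U^g$, a faithful unitary representation with $-I\notin\mathcal{G}:=U(G)$ (the stabilizer group). The code (perspective-neutral) space is $\mathcal{H}_{\rm pn}=\{\psi:U^g\psi=\psi\ \forall g\}$ with orthogonal projector $\Pi_{\rm pn}=\frac1{|G|}\sum_gU^g$. $\hat G$ is the group of characters $\chi:G\to\{\pm1\}$. A finite set $\mathcal{E}=\{E_i\}$ of operators is correctable if $\Pi_{\rm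 pn}E_i^\dagger E_j\Pi_{\rm pn}=C_{ij}\Pi_{\rm pn}$ for all $i,j$ with $(C_{ij})$ Hermitian (Knill–Laflamme); it is maximal if $\mathrm{rank}(C)=\lfloor\dim\mathcal{H}_{\rm kin}/\dim\mathcal{H}_{\rm pn}\rfloor$. Two correctable sets $\mathcal{E},\mathcal{E}'$ are equivalent if $\mathrm{span}_\mathbb{C}\{E\Pi_{\rm pn}:E\in\mathcal{E}\}=\mathrm{span}_\mathbb{C}\{E'\Pi_{\rm pn}:E'\in\mathcal{E}'\}$; $[\mathcal{E}]$ is the equivalence class. A unitary representation $\hat U_R$ of $\hat G$ on $\mathcal{H}_R$ is dual to $U_R$ if $U_R^g\hat U_R^\chi=\chi(g)\hat U^\chi_RU^g_R$ for all $g\in G,\chi\in\hat G$. *)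

theory Defs
  imports "Jordan_Normal_Form.Schur_Decomposition" "Jordan_Normal_Form.DL_Rank"
begin

abbreviation adj :: "complex mat \<Rightarrow> complex mat" where
  "adj A \<equiv> mat_adjoint A"

definition kron :: "complex mat \<Rightarrow> complex mat \<Rightarrow> complex mat" where
  "kron A B = mat (dim_row A * dim_row B) (dim_col A * dim_col B)
     (\<lambda>(i,j). A $$ (i div dim_row B, j div dim_col B) * B $$ (i mod dim_row B, j mod dim_col B))"

definition unitary_mat :: "nat \<Rightarrow> complex mat \<Rightarrow> bool" where
  "unitary_mat d W \<longleftrightarrow> W \<in> carrier_mat d d \<and> W * adj W = 1\<^sub>m d \<and> adj W * W = 1\<^sub>m d"

definition pauli1 :: "nat \<Rightarrow> complex mat" where
  "pauli1 p = (if p = 0 then 1\<^sub>m 2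
     else if p = 1 then mat_of_rows_list 2 [[0, 1], [1, 0]]
     else if p = 2 then mat_of_rows_list 2 [[0, -\<i>], [\<i>, 0]]
     else mat_of_rows_list 2 [[1, 0], [0, -1]])"

fun pauli_string :: "nat list \<Rightarrow> complex mat" where
  "pauli_string [] = 1\<^sub>m 1"
| "pauli_string (p # os) = kron (pauli1 p) (pauli_string os)"

definition pauli_group :: "nat \<Rightarrow> complex mat set" where
  "pauli_group n = {(\<i> ^ l) \<cdot>\<^sub>m pauli_string os | l os.
      l < 4 \<and> length os = n \<and> set os \<subseteq> {0..3}}"

definition Zgrp :: "nat \<Rightarrow> bool list set" where
  "Zgrp m = {xs. length xs = m}"

definition gmul :: "bool list \<Rightarrow> bool list \<Rightarrow> bool list" where
  "gmul g h = map2 (\<lambda>a b. a \<noteq> b) g h"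

definition chars :: "nat \<Rightarrow> (bool list \<Rightarrow> complex) set" where
  "chars m = {\<chi>. (\<forall>g\<in>Zgrp m. \<chi> g = 1 \<or> \<chi> g = -1)
      \<and> (\<forall>g\<in>Zgrp m. \<forall>h\<in>Zgrp m. \<chi> (gmul g h) = \<chi> g * \<chi> h)
      \<and> (\<forall>g. g \<notin> Zgrp m \<longrightarrow> \<chi> g = 1)}"

definition char_mul :: "(bool list \<Rightarrow> complex) \<Rightarrow> (bool list \<Rightarrow> complex) \<Rightarrow> (bool list \<Rightarrow> complex)" where
  "char_mul \<chi>1 \<chi>2 = (\<lambda>g. \<chi>1 g * \<chi>2 g)"

definition stab_rep :: "nat \<Rightarrow> nat \<Rightarrow> (bool list \<Rightarrow> complex mat) \<Rightarrow> bool" where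
  "stab_rep n k U \<longleftrightarrow>
     (\<forall>g\<in>Zgrp (n-k). U g \<in> pauli_group n)
   \<and> (\<forall>g\<in>Zgrp (n-k). \<forall>h\<in>Zgrp (n-k). U (gmul g h) = U g * U h)
   \<and> inj_on U (Zgrp (n-k))
   \<and> - 1\<^sub>m (2^n) \<notin> U ` Zgrp (n-k)"

definition proj_pn :: "nat \<Rightarrow> nat \<Rightarrow> (bool list \<Rightarrow> complex mat) \<Rightarrow> complex mat" where
  "proj_pn n k U = mat (2^n) (2^n)
     (\<lambda>ij. (\<Sum>g\<in>Zgrp (n-k). U g $$ ij) / of_nat (card (Zgrp (n-k))))"

definition mrank :: "nat \<Rightarrow> complex mat \<Rightarrow> nat" where
  "mrank d (A::complex mat) = vec_space.rank d A"

definition KL_matrix :: "nat \<Rightarrow> complex mat \<Rightarrow> complex mat list \<Rightarrow> complex mat \<Rightarrow> bool" where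
  "KL_matrix N P Es C \<longleftrightarrow> C \<in> carrier_mat (length Es) (length Es) \<and> C = adj C
     \<and> (\<forall>i<length Es. \<forall>j<length Es. P * adj (Es!i) * (Es!j) * P = C $$ (i,j) \<cdot>\<^sub>m P)"

definition correctable :: "nat \<Rightarrow> complex mat \<Rightarrow> complex mat list \<Rightarrow> bool" where
  "correctable N P Es \<longleftrightarrow> (\<forall>E\<in>set Es. E \<in> carrier_mat N N) \<and> (\<exists>C. KL_matrix N P Es C)"

definition max_correctable :: "nat \<Rightarrow> complex mat \<Rightarrow> complex mat list \<Rightarrow> bool" where
  "max_correctable N P Es \<longleftrightarrow> (\<forall>E\<in>set Es. E \<in> carrier_mat N N)
     \<and> (\<exists>C. KL_matrix N P Es C \<and> mrank (length Es) C = N div mrank N P)"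

inductive_set mspan :: "nat \<Rightarrow> complex mat set \<Rightarrow> complex mat set" for N S where
  zero: "0\<^sub>m N N \<in> mspan N S"
| add: "A \<in> mspan N S \<Longrightarrow> X \<in> S \<Longrightarrow> c \<cdot>\<^sub>m X + A \<in> mspan N S"

definition err_equiv :: "nat \<Rightarrow> complex mat \<Rightarrow> complex mat list \<Rightarrow> complex mat list \<Rightarrow> bool" where
  "err_equiv N P Es Es' \<longleftrightarrow> mspan N ((\<lambda>E. E * P) ` set Es) = mspan N ((\<lambda>E. E * P) ` set Es')"

inductive_set star_alg :: "nat \<Rightarrow> complex mat set \<Rightarrow> complex mat set" for N S where
  gen: "X \<in> S \<Longrightarrow> X \<in> star_alg N S"
| one: "1\<^sub>m N \<in> star_alg N S"
| add: "A \<in> star_alg N S \<Longrightarrow> B \<in> star_alg N S \<Longrightarrow> A + B \<in> star_alg N S"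
| mult: "A \<in> star_alg N S \<Longrightarrow> B \<in> star_alg N S \<Longrightarrow> A * B \<in> star_alg N S"
| smult: "A \<in> star_alg N S \<Longrightarrow> c \<cdot>\<^sub>m A \<in> star_alg N S"
| adj: "A \<in> star_alg N S \<Longrightarrow> adj A \<in> star_alg N S"

definition commutant :: "nat \<Rightarrow> complex mat set \<Rightarrow> complex mat set" where
  "commutant N A = {B \<in> carrier_mat N N. \<forall>X\<in>A. X * B = B * X}"

definition cinner :: "complex vec \<Rightarrow> complex vec \<Rightarrow> complex" where
  "cinner v w = (\<Sum>i<dim_vec v. cnj (v $ i) * w $ i)"

definition dual_rep :: "nat \<Rightarrow> nat \<Rightarrow> (bool list \<Rightarrow> complex mat)
     \<Rightarrow> ((bool list \<Rightarrow> complex) \<Rightarrow> complex mat) \<Rightarrow> bool" where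
  "dual_rep m d UR Uh \<longleftrightarrow>
     (\<forall>\<chi>\<in>chars m. unitary_mat d (Uh \<chi>))
   \<and> (\<forall>\<chi>1\<in>chars m. \<forall>\<chi>2\<in>chars m. Uh (char_mul \<chi>1 \<chi>2) = Uh \<chi>1 * Uh \<chi>2)
   \<and> (\<forall>g\<in>Zgrp m. \<forall>\<chi>\<in>chars m. UR g * Uh \<chi> = \<chi> g \<cdot>\<^sub>m (Uh \<chi> * UR g))"

end

theory Submission
  imports Defs
begin

text \<open>
  Write \<open>\<Pi>\<close> for the code projector and \<open>d = 2\<^bsup>n-k\<^esup>\<close>. A Pauli error \<open>E\<close> commutes with the stabilizers up to
  a character \<open>\<chi>\<close> of \<open>G\<close>, its syndrome. Errors with different syndromes map the code space to orthogonal
  subspaces, and correctable errors with the same syndrome are proportional on the code space. Hence the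
  rank of the Knill-Laflamme matrix is at most the number of syndromes that occur, and maximality means
  that all \<open>d\<close> characters occur. Choosing one error \<open>E\<^sub>\<chi>\<close> for each, the operators
  \<open>E\<^sub>\<chi> \<Pi> E\<^sub>\<psi>\<^sup>\<dagger>\<close> are matrix units of a full matrix algebra with multiplicity \<open>2\<^sup>k\<close>, in which \<open>U\<^sup>g\<close>
  is diagonal with entries \<open>\<chi>(g)\<close>; the Fourier transform of this basis consists of orientation states.

  Conversely \<open>\<Pi> = p \<otimes> I\<close> with \<open>p = v v\<^sup>\<dagger>\<close> of rank one (compare traces), so every admissible
  \<open>E \<Pi>\<close> has the form \<open>x v\<^sup>\<dagger> \<otimes> I\<close>, and maximality forces the vectors \<open>x\<close> to span \<open>\<complex>\<^sup>d\<close>.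
\<close>

section \<open>Adjoint, trace and rank\<close>

text \<open>The two directions have different data. Pauli errors are unitary and carry syndromes; in
  the converse the errors are arbitrary operators, and only the rank of the Knill-Laflamme matrix
  \<open>C\<close> is available. Rank enters both directions in the same form: if \<open>C\<close>
  has rank d, there are \<open>V\<close> and \<open>Y\<close> with \<open>V = C * Y\<close> and
  \<open>adj V * V\<close> the identity of size d. Substituting a factorization of \<open>C\<close>
  then writes this identity as a product, which bounds the number of syndromes in one direction and
  yields a right inverse in the other. The identity among the Pauli errors puts \<Pi> itself among
  the generators. Errors of trivial syndrome then act as scalars on the code, so no logical operator
  enters the algebra. An isomorphism of Hilbert spaces is a unitary \<open>W\<close>, and a pair (a,
  t) of indices of the two factors is the single index a * K + t.\<close>

lemma adj_carrier [simp]: "A \<in> carrier_mat r c \<Longrightarrow> adj A \<in> carrier_mat c r"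
  unfolding mat_adjoint_def by auto

lemma adj_dim [simp]: "dim_row (adj A) = dim_col A" "dim_col (adj A) = dim_row A"
  unfolding mat_adjoint_def by auto

lemma adj_index [simp]:
  "i < dim_col A \<Longrightarrow> j < dim_row A \<Longrightarrow> adj A $$ (i, j) = cnj (A $$ (j, i))"
  unfolding mat_adjoint_def by (simp add: mat_of_rows_index)

lemma mult_square_carrier [simp]:
  "A \<in> carrier_mat N N \<Longrightarrow> B \<in> carrier_mat N N \<Longrightarrow> A * B \<in> carrier_mat N N"
  by (rule mult_carrier_mat)

lemma one_mult_square [simp]:
  "A \<in> carrier_mat N N \<Longrightarrow> 1\<^sub>m N * A = A" "A \<in> carrier_mat N N \<Longrightarrow> A * 1\<^sub>m N = (A :: complex mat)"
  by auto

lemma one_smult_mat [simp]: "(1 :: complex) \<cdot>\<^sub>m A = A"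
  by (rule eq_matI) auto

lemma smult_smult_mat [simp]: "(a :: complex) \<cdot>\<^sub>m (b \<cdot>\<^sub>m A) = (a * b) \<cdot>\<^sub>m A"
  by (rule eq_matI) auto

lemma adj_adj [simp]: "adj (adj A) = A"
  by (rule eq_matI) auto

lemma adj_one [simp]: "adj (1\<^sub>m d) = 1\<^sub>m d"
  by (rule eq_matI) auto

lemma adj_smult: "adj (c \<cdot>\<^sub>m A) = cnj c \<cdot>\<^sub>m adj A"
  by (rule eq_matI) auto

lemma mult_index:
  "i < dim_row A \<Longrightarrow> j < dim_col B \<Longrightarrow> dim_col A = dim_row B \<Longrightarrow>
   (A * B) $$ (i, j) = (\<Sum>l<dim_row B. A $$ (i, l) * B $$ (l, j))"
  by (simp add: scalar_prod_def lessThan_atLeast0)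

lemma adj_mult:
  "A \<in> carrier_mat r m \<Longrightarrow> B \<in> carrier_mat m c \<Longrightarrow> adj (A * B) = adj B * adj A"
  by (rule eq_matI) (auto simp: mult_index mult.commute simp del: index_mult_mat(1))

definition mtrace :: "complex mat \<Rightarrow> complex" where
  "mtrace A = (\<Sum>i<dim_row A. A $$ (i, i))"

lemma mtrace_comm:
  assumes "A \<in> carrier_mat r c" "B \<in> carrier_mat c r"
  shows "mtrace (A * B) = mtrace (B * A)"
proof -
  have "mtrace (A * B) = (\<Sum>i<r. \<Sum>l<c. A $$ (i, l) * B $$ (l, i))"
    unfolding mtrace_def using assms by (auto simp: mult_index simp del: index_mult_mat(1))
  also have "\<dots> = (\<Sum>l<c. \<Sum>i<r. B $$ (l, i) * A $$ (i, l))"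
    by (subst sum.swap) (simp add: mult.commute)
  also have "\<dots> = mtrace (B * A)"
    unfolding mtrace_def using assms by (auto simp: mult_index simp del: index_mult_mat(1))
  finally show ?thesis .
qed

lemma mtrace_one [simp]: "mtrace (1\<^sub>m d) = of_nat d"
  unfolding mtrace_def by simp

lemma mtrace_smult: "A \<in> carrier_mat d d \<Longrightarrow> mtrace (c \<cdot>\<^sub>m A) = c * mtrace A"
  unfolding mtrace_def by (simp add: sum_distrib_left)

text \<open>A vector of \<open>S\<close> outside the span of \<open>U\<close> could be added to
  \<open>U\<close> without losing independence, against maximality. The rank is the size of such a
  maximal set of columns.\<close>

lemma (in vec_space) span_maximal_lin_indpt:
  assumes S: "S \<subseteq> carrier_vec n" and max: "maximal U (\<lambda>T. T \<subseteq> S \<and> lin_indpt T)"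
  shows "span U = span S"
proof
  have U: "U \<subseteq> S" "lin_indpt U" using max unfolding maximal_def by auto
  show "span U \<subseteq> span S" using U span_is_monotone by blast
  have "s \<in> span U" if s: "s \<in> S" for s
  proof (rule ccontr)
    assume ns: "s \<notin> span U"
    have sU: "s \<notin> U" using ns U S span_mem[of U s] by auto
    have "lin_indpt (insert s U)"
      using lin_dep_iff_in_span[of U s] U S s sU ns by auto
    then have "insert s U = U"
      using max U s unfolding maximal_def by blast
    then show False using sU by auto
  qed
  then show "span S \<subseteq> span U" using span_subsetI[of U S] U S by auto
qed

text \<open>An orthonormal basis \<open>V\<close> of the column space turns rank statements into matrix identities
  and traces.\<close>

lemma orthonormal_column_basis:
  assumes A: "A \<in> carrier_mat N m" and r: "r = mrank N A"
  obtains V X Y where "V \<in> carrier_mat N r" "X \<in> carrier_mat r m" "Y \<in> carrier_mat m r"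
    "adj V * V = 1\<^sub>m r" "A = V * X" "V = A * Y"
proof -
  interpret cof_vec_space N "TYPE(complex)" .
  let ?S = "set (cols A)"
  have S: "?S \<subseteq> carrier_vec N" using A cols_dim by blast
  obtain T where T: "maximal T (\<lambda>T. T \<subseteq> ?S \<and> lin_indpt T)" "finite T"
    using maximal_exists_superset[of ?S "\<lambda>T. T \<subseteq> ?S \<and> lin_indpt T" "{}"]
    by (metis (mono_tags, lifting) List.finite_set empty_subsetI finite_lin_indpt2 finite.emptyI
        emptyE)
  have TS: "T \<subseteq> ?S" "lin_indpt T" using T unfolding maximal_def by auto
  have spT: "span T = span ?S" by (rule span_maximal_lin_indpt[OF S T(1)])
  have rT: "r = card T" using rank_card_indpt[OF A T(1)] r unfolding mrank_def by simp
  obtain ws where ws: "set ws = T" "distinct ws" using T(2) finite_distinct_list by blast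
  define us where "us = gram_schmidt N ws"
  have wsc: "set ws \<subseteq> carrier_vec N" using ws TS S by auto
  note gs = gram_schmidt_result[OF wsc ws(2) _ us_def, unfolded ws(1), OF TS(2)]
  have lus: "length us = r" using gs(4) ws distinct_card rT by metis
  \<comment> \<open>Gram-Schmidt delivers orthogonal vectors that are not normalised, so their norms
    have to be divided out.\<close>
  define nr where "nr i = sqrt (Re (us ! i \<bullet>c us ! i))" for i
  have usc: "us ! i \<in> carrier_vec N" if "i < r" for i using gs(3) lus that by (auto simp: subset_iff)
  have ip: "us ! i \<bullet>c us ! j = (\<Sum>l<N. us ! i $ l * cnj (us ! j $ l))" if "i < r" "j < r" for i j
    using usc[OF that(1)] usc[OF that(2)] by (auto simp: scalar_prod_def lessThan_atLeast0)
  have ipr: "us ! i \<bullet>c us ! i = of_real (\<Sum>l<N. (cmod (us ! i $ l))\<^sup>2)" if "i < r" for i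
    by (simp only: ip[OF that that] of_real_sum complex_norm_square)
  have ip0: "us ! i \<bullet>c us ! j = 0 \<longleftrightarrow> i \<noteq> j" if "i < r" "j < r" for i j
    using corthogonalD[OF gs(2)] lus that by simp
  have nr2: "complex_of_real (nr i) * complex_of_real (nr i) = us ! i \<bullet>c us ! i" if "i < r" for i
    unfolding nr_def ipr[OF that]
    by (simp flip: of_real_mult add: sum_nonneg del: of_real_sum)
  have nr0: "nr i \<noteq> 0" if "i < r" for i
    using nr2[OF that] ip0[OF that that] by auto
  define B where "B = mat_of_cols N us"
  \<comment> \<open>\<open>D\<close> normalises the columns of \<open>B\<close> and
    \<open>D'\<close> undoes this, so \<open>V\<close> and \<open>B\<close> have the same column
    space.\<close>
  define D where "D = mat r r (\<lambda>(i,j). if i = j then complex_of_real (1 / nr i) else 0)"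
  define D' where "D' = mat r r (\<lambda>(i,j). if i = j then complex_of_real (nr i) else 0)"
  define V where "V = B * D"
  have Bc: "B \<in> carrier_mat N r" unfolding B_def using lus by auto
  have Dc: "D \<in> carrier_mat r r" "D' \<in> carrier_mat r r" unfolding D_def D'_def by auto
  have Vc: "V \<in> carrier_mat N r" unfolding V_def using Bc Dc by auto
  have DD: "D * D' = 1\<^sub>m r"
    by (rule eq_matI) (auto simp: D_def D'_def mult_index if_distrib[of "\<lambda>x. x * _"]
        if_distrib[of "\<lambda>x. _ * x"] nr0 cong: if_cong simp del: index_mult_mat(1))
  have VD: "V * D' = B" unfolding V_def using Bc Dc DD by (simp add: assoc_mult_mat[of _ N r _ r _ r])
  have Vi: "V $$ (l, i) = us ! i $ l / nr i" if "l < N" "i < r" for l i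
    using that Bc Dc lus unfolding V_def
    by (auto simp: mult_index D_def B_def mat_of_cols_index if_distrib[of "\<lambda>x. _ * x"]
        cong: if_cong simp del: index_mult_mat(1))
  have VV: "adj V * V = 1\<^sub>m r"
  proof (rule eq_matI)
    fix i j assume "i < dim_row (1\<^sub>m r :: complex mat)" "j < dim_col (1\<^sub>m r :: complex mat)"
    then have ij: "i < r" "j < r" by auto
    have "(adj V * V) $$ (i, j) = (\<Sum>l<N. us ! j $ l * cnj (us ! i $ l)) / (nr i * nr j)"
      using Vc ij by (auto simp: mult_index Vi sum_divide_distrib mult.commute
          simp del: index_mult_mat(1))
    also have "\<dots> = 1\<^sub>m r $$ (i, j)"
      using ip[OF ij(2,1)] ip0[OF ij(2,1)] nr2[OF ij(1)] nr0[OF ij(1)] ij by auto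
    finally show "(adj V * V) $$ (i, j) = 1\<^sub>m r $$ (i, j)" .
  qed (use Vc in auto)
  have csB: "span (set us) = {y\<in>carrier_vec N. \<exists>x\<in>carrier_vec r. B *\<^sub>v x = y}"
    using col_space_eq[OF Bc] gs(3)
    unfolding col_space_def carrier_matD[OF Bc] by (simp only: B_def cols_mat_of_cols)
  have csA: "span ?S = {y\<in>carrier_vec N. \<exists>x\<in>carrier_vec m. A *\<^sub>v x = y}"
    using col_space_eq[OF A] unfolding col_space_def carrier_matD[OF A] .
  have eqsp: "span (set us) = span ?S" using gs(1) spT by simp
  \<comment> \<open>Inclusion of column spaces becomes a matrix identity: the solutions of
    \<open>L *\<^sub>v x = col M j\<close> are collected as the columns of \<open>X\<close>.\<close>
  have factor: "\<exists>X\<in>carrier_mat q s. M = L * X"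
    if L: "L \<in> carrier_mat N q" and M: "M \<in> carrier_mat N s"
      and ex: "\<And>j. j < s \<Longrightarrow> \<exists>x\<in>carrier_vec q. L *\<^sub>v x = col M j" for L M :: "complex mat" and q s
  proof -
    obtain x where x: "\<And>j. j < s \<Longrightarrow> x j \<in> carrier_vec q \<and> L *\<^sub>v x j = col M j"
      using ex by metis
    define X where "X = mat q s (\<lambda>(i,j). x j $ i)"
    have "M = L * X"
    proof (rule eq_matI)
      fix i j assume "i < dim_row (L * X)" "j < dim_col (L * X)"
      then have ij: "i < N" "j < s" using L X_def by auto
      have "col X j = x j" using x[OF ij(2)] ij unfolding X_def by auto
      then have "(L * X) $$ (i, j) = (L *\<^sub>v x j) $ i" using ij L X_def by auto
      then show "M $$ (i, j) = (L * X) $$ (i, j)" using x[OF ij(2)] ij M by auto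
    qed (use L M X_def in auto)
    then show ?thesis using X_def by auto
  qed
  have "\<exists>X\<in>carrier_mat r m. A = B * X"
  proof (rule factor[OF Bc A])
    fix j assume j: "j < m"
    have "col A j \<in> ?S" using A j by (auto simp: cols_def)
    then have "col A j \<in> span ?S" using span_mem[OF S] by blast
    then show "\<exists>x\<in>carrier_vec r. B *\<^sub>v x = col A j" unfolding eqsp[symmetric] csB by auto
  qed
  then obtain X where X: "X \<in> carrier_mat r m" "A = B * X" by auto
  have "\<exists>Y\<in>carrier_mat m r. B = A * Y"
  proof (rule factor[OF A Bc])
    fix j assume j: "j < r"
    have "us ! j \<in> set us" using j lus by auto
    then have "us ! j \<in> span (set us)" using span_mem[OF gs(3)] by blast
    then show "\<exists>x\<in>carrier_vec m. A *\<^sub>v x = col B j"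
      unfolding eqsp csA B_def using j lus usc[OF j] by auto
  qed
  then obtain Y where Y: "Y \<in> carrier_mat m r" "B = A * Y" by auto
  show ?thesis
  proof
    show "V \<in> carrier_mat N r" by (rule Vc)
    show "D' * X \<in> carrier_mat r m" using Dc X by auto
    show "Y * D \<in> carrier_mat m r" using Dc Y by auto
    show "adj V * V = 1\<^sub>m r" by (rule VV)
    show "A = V * (D' * X)"
      using assoc_mult_mat[OF Vc Dc(2) X(1)] VD X(2) by simp
    show "V = A * (Y * D)"
      using assoc_mult_mat[OF A Y(1) Dc(1)] Y(2) V_def by simp
  qed
qed

text \<open>Multiplying \<open>1 = V * X\<close> by \<open>adj V\<close> gives
  \<open>X = adj V\<close>, so \<open>V\<close> is unitary, and the traces of the two products of
  \<open>V\<close> and \<open>adj V\<close> are d and the rank.\<close>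

lemma mrank_one: "mrank d (1\<^sub>m d) = d"
proof -
  let ?r = "mrank d (1\<^sub>m d)"
  obtain V X where VX: "V \<in> carrier_mat d ?r" "X \<in> carrier_mat ?r d"
     "adj V * V = 1\<^sub>m ?r" "1\<^sub>m d = V * X"
    using orthonormal_column_basis[OF one_carrier_mat refl, of d] by metis
  have "adj V = adj V * (V * X)" unfolding VX(4)[symmetric] using VX(1) by simp
  also have "\<dots> = X"
    using assoc_mult_mat[OF adj_carrier[OF VX(1)] VX(1,2)] VX(2,3) by simp
  finally have "1\<^sub>m d = V * adj V" using VX(4) by simp
  then have "of_nat d = mtrace (V * adj V)" by (metis mtrace_one)
  also have "\<dots> = of_nat ?r" using mtrace_comm[of V d ?r "adj V"] VX by simp
  finally show ?thesis by (metis of_nat_eq_iff)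
qed

text \<open>For an orthogonal projector the trace is the rank, so dimensions can be read off from
  traces.\<close>

lemma projector_factorization:
  assumes P: "P \<in> carrier_mat N N" and herm: "adj P = P" and idem: "P * P = P"
    and tr: "mtrace P = of_nat r"
  shows "mrank N P = r"
    and "\<exists>V. V \<in> carrier_mat N r \<and> adj V * V = 1\<^sub>m r \<and> P = V * adj V \<and> P * V = V"
proof -
  define s where "s = mrank N P"
  obtain V X Y where V: "V \<in> carrier_mat N s" "X \<in> carrier_mat s N" "Y \<in> carrier_mat N s"
     "adj V * V = 1\<^sub>m s" "P = V * X" "V = P * Y"
    using orthonormal_column_basis[OF P s_def] by metis
  have aV: "adj V \<in> carrier_mat s N" using V(1) by simp
  have PV: "P * V = V"
    using assoc_mult_mat[OF P P V(3)] idem unfolding V(6) by simp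
  have "adj V * P = X"
    using assoc_mult_mat[OF aV V(1,2)] V(2,4) unfolding V(5) by simp
  \<comment> \<open>\<open>V * adj V\<close> fixes the range of \<open>P\<close>. The adjoint of
    this identity, together with \<open>P * V = V\<close>, shows that the two projectors
    coincide.\<close>
  then have 1: "V * adj V * P = P" using assoc_mult_mat[OF V(1) aV P] V(5) by simp
  have "adj (V * adj V * P) = adj P" by (simp add: 1)
  also have "adj (V * adj V * P) = P * (V * adj V)"
    using V(1) aV P by (simp add: adj_mult[of _ N N _ N] adj_mult[of _ N s _ N] herm)
  also have "\<dots> = V * adj V" using assoc_mult_mat[OF P V(1) aV] PV by simp
  finally have PVV: "P = V * adj V" using herm by simp
  have "of_nat r = mtrace (V * adj V)" using tr PVV by simp
  also have "\<dots> = of_nat s" using mtrace_comm[OF V(1) aV] V(4) by simp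
  finally have "s = r" by simp
  then show "mrank N P = r"
    "\<exists>V. V \<in> carrier_mat N r \<and> adj V * V = 1\<^sub>m r \<and> P = V * adj V \<and> P * V = V"
    using s_def V(1,4) PVV PV by blast+
qed

section \<open>Kronecker products and averages\<close>

text \<open>Quotient and remainder by \<open>b\<close> are exactly how \<open>kron\<close> splits
  its indices.\<close>

lemma sum_lessThan_mult:
  fixes f :: "nat \<Rightarrow> 'a :: comm_monoid_add"
  shows "(\<Sum>l<a*b. f l) = (\<Sum>x<a. \<Sum>y<b. f (x * b + y))"
proof -
  have "(\<Sum>x<a. \<Sum>y<b. f (x * b + y)) = (\<Sum>x<a. sum f {x*b..<x*b+b})"
  proof (rule sum.cong[OF refl])
    fix x
    have "sum f {0 + x*b..<b + x*b} = sum (\<lambda>y. f (y + x*b)) {0..<b}"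
      by (rule sum.shift_bounds_nat_ivl)
    then show "(\<Sum>y<b. f (x * b + y)) = sum f {x*b..<x*b+b}"
      by (simp add: add.commute lessThan_atLeast0)
  qed
  then show ?thesis by (simp add: sum.nat_group)
qed

lemma div_mod_less [simp]:
  fixes i a b :: nat
  assumes "i < a * b"
  shows "i div b < a" "i mod b < b"
proof -
  have "b > 0" using assms by (cases b) auto
  then show "i div b < a" "i mod b < b"
    using assms by (auto simp: less_mult_imp_div_less)
qed

lemma pair_index_less:
  fixes x y a b :: nat
  assumes "x < a" "y < b"
  shows "x * b + y < a * b"
proof -
  have "x * b + y < (x + 1) * b" using assms by simp
  also have "\<dots> \<le> a * b" using assms by (intro mult_right_mono) auto
  finally show ?thesis .
qed

lemma kron_dim [simp]:
  "dim_row (kron A B) = dim_row A * dim_row B" "dim_col (kron A B) = dim_col A * dim_col B"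
  unfolding kron_def by auto

lemma kron_carrier [simp]:
  "A \<in> carrier_mat r c \<Longrightarrow> B \<in> carrier_mat s e \<Longrightarrow> kron A B \<in> carrier_mat (r * s) (c * e)"
  unfolding kron_def by auto

lemma kron_index:
  "i < dim_row A * dim_row B \<Longrightarrow> j < dim_col A * dim_col B \<Longrightarrow>
   kron A B $$ (i, j) = A $$ (i div dim_row B, j div dim_col B) * B $$ (i mod dim_row B, j mod dim_col B)"
  unfolding kron_def by simp

lemma kron_mult:
  assumes A: "A \<in> carrier_mat r m" and B: "B \<in> carrier_mat s l"
    and C: "C \<in> carrier_mat m c" and D: "D \<in> carrier_mat l e"
  shows "kron A B * kron C D = kron (A * C) (B * D)"
proof (rule eq_matI)
  fix i j assume "i < dim_row (kron (A * C) (B * D))" "j < dim_col (kron (A * C) (B * D))"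
  then have i: "i < r * s" and j: "j < c * e" using assms by auto
  have "(kron A B * kron C D) $$ (i, j) = (\<Sum>x<m*l. kron A B $$ (i, x) * kron C D $$ (x, j))"
    using i j assms by (auto simp: mult_index simp del: index_mult_mat(1))
  also have "\<dots> = (\<Sum>x<m*l. A $$ (i div s, x div l) * B $$ (i mod s, x mod l)
      * (C $$ (x div l, j div e) * D $$ (x mod l, j mod e)))"
    using i j assms by (intro sum.cong) (auto simp: kron_index)
  also have "\<dots> = (\<Sum>x<m. \<Sum>y<l. A $$ (i div s, x) * B $$ (i mod s, y)
      * (C $$ (x, j div e) * D $$ (y, j mod e)))"
    unfolding sum_lessThan_mult by (intro sum.cong) auto
  also have "\<dots> = (\<Sum>x<m. A $$ (i div s, x) * C $$ (x, j div e)) * (\<Sum>y<l. B $$ (i mod s, y) * D $$ (y, j mod e))"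
    by (simp add: sum_product mult_ac)
  also have "\<dots> = kron (A * C) (B * D) $$ (i, j)"
    using i j assms by (auto simp: mult_index kron_index simp del: index_mult_mat(1))
  finally show "(kron A B * kron C D) $$ (i, j) = kron (A * C) (B * D) $$ (i, j)" .
qed (use assms in auto)

lemma adj_kron: "adj (kron A B) = kron (adj A) (adj B)"
  by (rule eq_matI) (auto simp: kron_index)

lemma kron_one: "kron (1\<^sub>m a) (1\<^sub>m b) = 1\<^sub>m (a * b)"
proof (rule eq_matI)
  fix i j assume "i < dim_row (1\<^sub>m (a * b) :: complex mat)" "j < dim_col (1\<^sub>m (a * b) :: complex mat)"
  then have ij: "i < a * b" "j < a * b" by auto
  have "i = j \<longleftrightarrow> i div b = j div b \<and> i mod b = j mod b" by (metis div_mult_mod_eq)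
  then show "kron (1\<^sub>m a) (1\<^sub>m b) $$ (i, j) = 1\<^sub>m (a * b) $$ (i, j)"
    using ij by (auto simp: kron_index)
qed auto

lemma kron_add_left:
  "A \<in> carrier_mat r c \<Longrightarrow> B \<in> carrier_mat r c \<Longrightarrow> kron (A + B) C = kron A C + kron B C"
  by (rule eq_matI) (auto simp: kron_index distrib_right)

lemma kron_smult: "kron (x \<cdot>\<^sub>m A) (y \<cdot>\<^sub>m B) = (x * y) \<cdot>\<^sub>m kron A B"
  by (rule eq_matI) (auto simp: kron_index)

lemma kron_smult_left: "kron (x \<cdot>\<^sub>m A) B = x \<cdot>\<^sub>m kron A B"
  by (rule eq_matI) (auto simp: kron_index)

lemma mtrace_kron:
  assumes "A \<in> carrier_mat a a" "B \<in> carrier_mat b b"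
  shows "mtrace (kron A B) = mtrace A * mtrace B"
proof -
  have "mtrace (kron A B) = (\<Sum>i<a*b. A $$ (i div b, i div b) * B $$ (i mod b, i mod b))"
    unfolding mtrace_def using assms by (auto simp: kron_index)
  also have "\<dots> = (\<Sum>x<a. \<Sum>y<b. A $$ (x, x) * B $$ (y, y))"
    unfolding sum_lessThan_mult by (intro sum.cong) auto
  finally show ?thesis unfolding mtrace_def using assms by (simp add: sum_product)
qed

text \<open>The top left entry of each K by K block recovers the entry of the first factor.\<close>

lemma kron_one_right_inject:
  assumes A: "A \<in> carrier_mat r c" "B \<in> carrier_mat r c" and K: "K > 0"
    and eq: "kron A (1\<^sub>m K) = kron B (1\<^sub>m K)"
  shows "A = B"
proof (rule eq_matI)
  fix i j assume "i < dim_row B" "j < dim_col B"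
  then have ij: "i < r" "j < c" using A by auto
  have *: "kron X (1\<^sub>m K) $$ (i * K, j * K) = X $$ (i, j)" if "X \<in> carrier_mat r c" for X
    using pair_index_less[OF ij(1) K] pair_index_less[OF ij(2) K] that K
    by (auto simp: kron_index)
  show "A $$ (i, j) = B $$ (i, j)" using *[OF A(1)] *[OF A(2)] eq by simp
qed (use A in auto)

section \<open>Averages of operators over a finite set; the code projector is one of them\<close>

definition avg_mat :: "nat \<Rightarrow> 'g set \<Rightarrow> ('g \<Rightarrow> complex mat) \<Rightarrow> complex mat" where
  "avg_mat N G f = mat N N (\<lambda>ij. (\<Sum>g\<in>G. f g $$ ij) / of_nat (card G))"

lemma avg_mat_carrier [simp]: "avg_mat N G f \<in> carrier_mat N N"
  "dim_row (avg_mat N G f) = N" "dim_col (avg_mat N G f) = N"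
  unfolding avg_mat_def by auto

lemma avg_mat_cong:
  "(\<And>g. g \<in> G \<Longrightarrow> f g = h g) \<Longrightarrow> avg_mat N G f = avg_mat N G h"
  unfolding avg_mat_def by simp

lemma avg_mat_const:
  "finite G \<Longrightarrow> G \<noteq> {} \<Longrightarrow> A \<in> carrier_mat N N \<Longrightarrow> avg_mat N G (\<lambda>_. A) = A"
  unfolding avg_mat_def by (rule eq_matI) auto

lemma mult_avg_mat:
  assumes "A \<in> carrier_mat N N" "\<And>g. g \<in> G \<Longrightarrow> f g \<in> carrier_mat N N"
  shows "A * avg_mat N G f = avg_mat N G (\<lambda>g. A * f g)"
proof (rule eq_matI)
  fix i j assume "i < dim_row (avg_mat N G (\<lambda>g. A * f g))" "j < dim_col (avg_mat N G (\<lambda>g. A * f g))"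
  then have ij: "i < N" "j < N" by auto
  have "(A * avg_mat N G f) $$ (i, j) = (\<Sum>l<N. A $$ (i, l) * ((\<Sum>g\<in>G. f g $$ (l, j)) / card G))"
    using ij assms by (auto simp: mult_index avg_mat_def simp del: index_mult_mat(1))
  also have "\<dots> = (\<Sum>g\<in>G. (\<Sum>l<N. A $$ (i, l) * f g $$ (l, j))) / card G"
    by (simp add: sum_distrib_left sum_divide_distrib sum.swap[of _ G])
  also have "\<dots> = (\<Sum>g\<in>G. (A * f g) $$ (i, j)) / card G"
  proof -
    have "(A * f g) $$ (i, j) = (\<Sum>l<N. A $$ (i, l) * f g $$ (l, j))" if "g \<in> G" for g
      using ij assms(1) assms(2)[OF that] by (auto simp: mult_index simp del: index_mult_mat(1))
    then show ?thesis by simp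
  qed
  also have "\<dots> = avg_mat N G (\<lambda>g. A * f g) $$ (i, j)" using ij by (simp add: avg_mat_def)
  finally show "(A * avg_mat N G f) $$ (i, j) = avg_mat N G (\<lambda>g. A * f g) $$ (i, j)" .
qed (use assms in auto)

lemma adj_avg_mat:
  assumes "\<And>g. g \<in> G \<Longrightarrow> f g \<in> carrier_mat N N"
  shows "adj (avg_mat N G f) = avg_mat N G (\<lambda>g. adj (f g))"
proof (rule eq_matI)
  fix i j assume ij: "i < dim_row (avg_mat N G (\<lambda>g. adj (f g)))" "j < dim_col (avg_mat N G (\<lambda>g. adj (f g)))"
  have "adj (f g) $$ (i, j) = cnj (f g $$ (j, i))" if "g \<in> G" for g
    using assms[OF that] ij by auto
  then show "adj (avg_mat N G f) $$ (i, j) = avg_mat N G (\<lambda>g. adj (f g)) $$ (i, j)"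
    using ij by (simp add: avg_mat_def)
qed (use assms in auto)

lemma avg_mat_mult:
  assumes "A \<in> carrier_mat N N" "\<And>g. g \<in> G \<Longrightarrow> f g \<in> carrier_mat N N"
  shows "avg_mat N G f * A = avg_mat N G (\<lambda>g. f g * A)"
proof -
  have "adj (avg_mat N G f * A) = adj A * adj (avg_mat N G f)"
    by (rule adj_mult[of _ N N _ N]) (use assms in auto)
  also have "\<dots> = avg_mat N G (\<lambda>g. adj A * adj (f g))"
    using assms by (simp add: adj_avg_mat mult_avg_mat)
  also have "\<dots> = avg_mat N G (\<lambda>g. adj (f g * A))"
    using assms by (intro avg_mat_cong) (simp add: adj_mult[of _ N N _ N])
  also have "\<dots> = adj (avg_mat N G (\<lambda>g. f g * A))"
    by (rule adj_avg_mat[symmetric]) (use assms in auto)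
  finally show ?thesis by (metis adj_adj)
qed

lemma kron_avg_mat:
  assumes "\<And>g. g \<in> G \<Longrightarrow> f g \<in> carrier_mat d d" and B: "B \<in> carrier_mat K K"
  shows "kron (avg_mat d G f) B = avg_mat (d * K) G (\<lambda>g. kron (f g) B)"
proof (rule eq_matI)
  fix i j assume "i < dim_row (avg_mat (d * K) G (\<lambda>g. kron (f g) B))"
    "j < dim_col (avg_mat (d * K) G (\<lambda>g. kron (f g) B))"
  then have ij: "i < d * K" "j < d * K" by auto
  have "kron (f g) B $$ (i, j) = f g $$ (i div K, j div K) * B $$ (i mod K, j mod K)" if "g \<in> G" for g
    using assms(1)[OF that] B ij by (auto simp: kron_index)
  then show "kron (avg_mat d G f) B $$ (i, j) = avg_mat (d * K) G (\<lambda>g. kron (f g) B) $$ (i, j)"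
    using ij B by (simp add: avg_mat_def kron_index sum_distrib_right)
qed (use B in auto)

lemma mtrace_avg_mat:
  assumes "\<And>g. g \<in> G \<Longrightarrow> f g \<in> carrier_mat N N"
  shows "mtrace (avg_mat N G f) = (\<Sum>g\<in>G. mtrace (f g)) / card G"
proof -
  have "mtrace (f g) = (\<Sum>i<N. f g $$ (i, i))" if "g \<in> G" for g
    using assms[OF that] by (auto simp: mtrace_def)
  then show ?thesis
    by (simp add: mtrace_def avg_mat_def sum_divide_distrib[symmetric] sum.swap[of _ G])
qed

section \<open>Unitary matrices\<close>

lemma unitary_matD:
  assumes "unitary_mat N W"
  shows "W \<in> carrier_mat N N" "W * adj W = 1\<^sub>m N" "adj W * W = 1\<^sub>m N"
  using assms unfolding unitary_mat_def by auto

lemma unitary_smult_cancel: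
  assumes W: "unitary_mat N W" and N: "N > 0" and eq: "a \<cdot>\<^sub>m W = b \<cdot>\<^sub>m W"
  shows "a = b"
proof -
  have "a \<cdot>\<^sub>m 1\<^sub>m N = adj W * (a \<cdot>\<^sub>m W)" "b \<cdot>\<^sub>m 1\<^sub>m N = adj W * (b \<cdot>\<^sub>m W)"
    using unitary_matD[OF W] by (auto simp: mult_smult_distrib[of _ N N])
  then have "(a \<cdot>\<^sub>m 1\<^sub>m N) $$ (0,0) = (b \<cdot>\<^sub>m 1\<^sub>m N) $$ (0,0)" using eq by simp
  then show ?thesis using N by simp
qed

lemma unitary_mult:
  assumes "unitary_mat N A" "unitary_mat N B"
  shows "unitary_mat N (A * B)"
proof -
  note A = unitary_matD[OF assms(1)] and B = unitary_matD[OF assms(2)]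
  have c: "adj A \<in> carrier_mat N N" "adj B \<in> carrier_mat N N" using A B by auto
  have "A * B * (adj B * adj A) = A * (B * adj B) * adj A" 
    using A(1) B(1) c by (simp add: assoc_mult_mat[of _ N N _ N _ N])
  moreover have "adj B * adj A * (A * B) = adj B * (adj A * A) * B"
    using A(1) B(1) c by (simp add: assoc_mult_mat[of _ N N _ N _ N])
  ultimately show ?thesis unfolding unitary_mat_def using A B c by (simp add: adj_mult[of _ N N _ N])
qed

section \<open>Characters of elementary abelian 2-groups\<close>

lemma finite_Zgrp [simp]: "finite (Zgrp m)"
  and card_Zgrp [simp]: "card (Zgrp m) = 2 ^ m"
proof -
  have Z: "Zgrp m = {xs. set xs \<subseteq> (UNIV :: bool set) \<and> length xs = m}" unfolding Zgrp_def by auto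
  show "finite (Zgrp m)" unfolding Z by (rule finite_lists_length_eq) simp
  show "card (Zgrp m) = 2 ^ m" unfolding Z by (subst card_lists_length_eq) (auto simp: card_UNIV_bool)
qed

abbreviation gid :: "nat \<Rightarrow> bool list" where "gid m \<equiv> replicate m False"

lemma gid_in [simp]: "gid m \<in> Zgrp m" unfolding Zgrp_def by simp

lemma Zgrp_nonempty [simp]: "Zgrp m \<noteq> {}" using gid_in by blast

lemma gmul_in [simp]: "g \<in> Zgrp m \<Longrightarrow> h \<in> Zgrp m \<Longrightarrow> gmul g h \<in> Zgrp m"
  unfolding Zgrp_def gmul_def by simp

lemma gmul_cancel: "g \<in> Zgrp m \<Longrightarrow> h \<in> Zgrp m \<Longrightarrow> gmul g (gmul g h) = h"
  unfolding Zgrp_def gmul_def by (auto intro!: nth_equalityI)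

lemma gmul_eq_gid: "g \<in> Zgrp m \<Longrightarrow> h \<in> Zgrp m \<Longrightarrow> gmul g h = gid m \<longleftrightarrow> g = h"
  unfolding Zgrp_def gmul_def by (auto simp: list_eq_iff_nth_eq)

lemma gmul_gid [simp]: "g \<in> Zgrp m \<Longrightarrow> gmul (gid m) g = g"
  unfolding Zgrp_def gmul_def by (auto simp: list_eq_iff_nth_eq)

lemma bij_gmul: "g \<in> Zgrp m \<Longrightarrow> bij_betw (gmul g) (Zgrp m) (Zgrp m)"
  by (rule bij_betw_byWitness[where f' = "gmul g"]) (auto simp: gmul_cancel)

text \<open>Translation permutes the group. This invariance is what makes the stabilizers fix the
  code projector.\<close>

lemma avg_mat_gmul:
  "h \<in> Zgrp m \<Longrightarrow> avg_mat N (Zgrp m) (\<lambda>g. f (gmul h g)) = avg_mat N (Zgrp m) f"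
  unfolding avg_mat_def by (simp add: sum.reindex_bij_betw[OF bij_gmul, of h m "\<lambda>g. f g $$ _"])

lemma charsD:
  assumes "\<chi> \<in> chars m"
  shows "g \<in> Zgrp m \<Longrightarrow> \<chi> g = 1 \<or> \<chi> g = -1"
    and "g \<in> Zgrp m \<Longrightarrow> h \<in> Zgrp m \<Longrightarrow> \<chi> (gmul g h) = \<chi> g * \<chi> h"
    and "g \<notin> Zgrp m \<Longrightarrow> \<chi> g = 1"
  using assms unfolding chars_def by auto

lemma char_square: "\<chi> \<in> chars m \<Longrightarrow> g \<in> Zgrp m \<Longrightarrow> \<chi> g * \<chi> g = 1"
  using charsD(1) by fastforce

lemma char_mul_in [simp]: "\<chi> \<in> chars m \<Longrightarrow> \<psi> \<in> chars m \<Longrightarrow> char_mul \<chi> \<psi> \<in> chars m"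
  unfolding chars_def char_mul_def by (fastforce simp: mult_ac)

lemma one_in_chars [simp]: "(\<lambda>_. 1) \<in> chars m"
  unfolding chars_def by auto

text \<open>The convention that a character is 1 outside the group makes it a total function
  determined by finitely many signs.\<close>

lemma finite_chars [simp]: "finite (chars m)"
proof (rule finite_subset)
  show "chars m \<subseteq> {f. \<forall>x. (x \<in> Zgrp m \<longrightarrow> f x \<in> {1, -1}) \<and> (x \<notin> Zgrp m \<longrightarrow> f x = 1)}"
    unfolding chars_def by auto
  show "finite {f :: bool list \<Rightarrow> complex. \<forall>x. (x \<in> Zgrp m \<longrightarrow> f x \<in> {1, -1}) \<and> (x \<notin> Zgrp m \<longrightarrow> f x = 1)}"
    by (rule finite_set_of_finite_funs) auto
qed

text \<open>Values are signs, so characters that differ at \<open>g\<close> have product -1 there.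
  This sign later forces operators that equal their own negative to vanish.\<close>

lemma chars_neqE:
  assumes "\<chi> \<in> chars m" "\<psi> \<in> chars m" "\<chi> \<noteq> \<psi>"
  obtains g where "g \<in> Zgrp m" "\<chi> g * \<psi> g = -1"
proof -
  obtain g where g: "\<chi> g \<noteq> \<psi> g" using assms by blast
  then have gZ: "g \<in> Zgrp m" using charsD(3) assms by metis
  have "\<chi> g * \<psi> g = -1"
    using charsD(1)[OF assms(1) gZ] charsD(1)[OF assms(2) gZ] g by auto
  then show ?thesis using that gZ by blast
qed

text \<open>Shifting the summation by an \<open>h\<close> at which the product is -1 negates the
  sum. No conjugate appears because the characters are real.\<close>

lemma sum_char_Zgrp:
  assumes "\<chi> \<in> chars m" "\<psi> \<in> chars m"
  shows "(\<Sum>g\<in>Zgrp m. \<chi> g * \<psi> g) = (if \<chi> = \<psi> then 2 ^ m else 0)"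
proof (cases "\<chi> = \<psi>")
  case True
  then show ?thesis using char_square[OF assms(1)] by simp
next
  case False
  then obtain h where h: "h \<in> Zgrp m" "\<chi> h * \<psi> h = -1" using chars_neqE assms by metis
  have "(\<Sum>g\<in>Zgrp m. \<chi> g * \<psi> g) = (\<Sum>g\<in>Zgrp m. \<chi> (gmul h g) * \<psi> (gmul h g))"
    by (rule sum.reindex_bij_betw[OF bij_gmul[OF h(1)], symmetric])
  also have "\<dots> = (\<Sum>g\<in>Zgrp m. (\<chi> h * \<psi> h) * (\<chi> g * \<psi> g))"
    using h(1) assms by (intro sum.cong) (auto simp: charsD(2))
  also have "\<dots> = - (\<Sum>g\<in>Zgrp m. \<chi> g * \<psi> g)"
    using h by (simp add: sum_negf)
  finally show ?thesis using False by simp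
qed

lemma char_separates:
  assumes "g \<in> Zgrp m" "g \<noteq> gid m"
  obtains \<chi> where "\<chi> \<in> chars m" "\<chi> g = -1"
proof -
  obtain i where i: "i < m" "g ! i" using assms unfolding Zgrp_def by (auto simp: list_eq_iff_nth_eq)
  \<comment> \<open>The sign character of a coordinate in which \<open>g\<close> is set, continued
    by 1 outside the group.\<close>
  define \<chi> :: "bool list \<Rightarrow> complex" where "\<chi> x = (if x \<in> Zgrp m \<and> x ! i then -1 else 1)" for x
  have "\<chi> \<in> chars m" unfolding chars_def
  proof (intro CollectI conjI ballI allI impI)
    fix x y assume xy: "x \<in> Zgrp m" "y \<in> Zgrp m"
    then have "gmul x y ! i = (x ! i \<noteq> y ! i)" using i unfolding gmul_def Zgrp_def by auto
    then show "\<chi> (gmul x y) = \<chi> x * \<chi> y" using xy unfolding \<chi>_def by auto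
  qed (auto simp: \<chi>_def)
  moreover have "\<chi> g = -1" using i assms by (simp add: \<chi>_def)
  ultimately show ?thesis using that by blast
qed

text \<open>The dual shift: multiplication by a character that is -1 at \<open>g\<close> permutes
  the characters and negates the sum.\<close>

lemma sum_chars_nontrivial:
  assumes "g \<in> Zgrp m" "g \<noteq> gid m"
  shows "(\<Sum>\<chi>\<in>chars m. \<chi> g) = 0"
proof -
  obtain \<psi> where \<psi>: "\<psi> \<in> chars m" "\<psi> g = -1" using char_separates assms by metis
  have inv: "char_mul \<psi> (char_mul \<psi> \<chi>) = \<chi>" if "\<chi> \<in> chars m" for \<chi>
  proof
    fix x show "char_mul \<psi> (char_mul \<psi> \<chi>) x = \<chi> x"
      using char_square[OF \<psi>(1), of x] charsD(3)[OF \<psi>(1), of x]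
      by (cases "x \<in> Zgrp m") (auto simp: char_mul_def mult.assoc[symmetric])
  qed
  have "bij_betw (char_mul \<psi>) (chars m) (chars m)"
    by (rule bij_betw_byWitness[where f' = "char_mul \<psi>"]) (use inv \<psi> in auto)
  from sum.reindex_bij_betw[OF this, of "\<lambda>\<chi>. \<chi> g"]
  have "(\<Sum>\<chi>\<in>chars m. \<chi> g) = (\<Sum>\<chi>\<in>chars m. \<psi> g * \<chi> g)" by (simp add: char_mul_def)
  then show ?thesis using \<psi> by (simp add: sum_negf)
qed

lemma char_gid: "\<chi> \<in> chars m \<Longrightarrow> \<chi> (gid m) = 1"
  using charsD(2)[of \<chi> m "gid m" "gid m"] charsD(1)[of \<chi> m "gid m"] by auto

text \<open>Both orthogonality relations applied to the double sum of all character values.\<close>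

lemma card_chars [simp]: "card (chars m) = 2 ^ m"
proof -
  have "(\<Sum>\<chi>\<in>chars m. \<Sum>g\<in>Zgrp m. \<chi> g) = (\<Sum>\<chi>\<in>chars m. if \<chi> = (\<lambda>_. 1) then 2 ^ m else 0)"
    using sum_char_Zgrp[OF _ one_in_chars] by (intro sum.cong) auto
  then have 1: "(\<Sum>\<chi>\<in>chars m. \<Sum>g\<in>Zgrp m. \<chi> g) = 2 ^ m" by simp
  have "(\<Sum>g\<in>Zgrp m. \<Sum>\<chi>\<in>chars m. \<chi> g) = (\<Sum>g\<in>Zgrp m. if g = gid m then of_nat (card (chars m)) else 0)"
    using sum_chars_nontrivial by (intro sum.cong) (auto simp: char_gid)
  then have "(\<Sum>g\<in>Zgrp m. \<Sum>\<chi>\<in>chars m. \<chi> g) = complex_of_nat (card (chars m))" by simp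
  then have "complex_of_nat (card (chars m)) = of_nat (2 ^ m)"
    using 1 by (subst (asm) sum.swap) simp
  then show ?thesis by (simp only: of_nat_eq_iff)
qed

text \<open>Every element is its own inverse, so the product of \<open>g\<close> and
  \<open>h\<close> is trivial exactly when they agree. This relation makes the orientation states
  orthonormal, while \<open>sum_char_Zgrp\<close> makes them complete.\<close>

lemma sum_chars:
  assumes "g \<in> Zgrp m" "h \<in> Zgrp m"
  shows "(\<Sum>\<chi>\<in>chars m. \<chi> g * \<chi> h) = (if g = h then 2 ^ m else 0)"
proof -
  have "(\<Sum>\<chi>\<in>chars m. \<chi> g * \<chi> h) = (\<Sum>\<chi>\<in>chars m. \<chi> (gmul g h))"
    using assms by (intro sum.cong) (auto simp: charsD(2))
  also have "\<dots> = (if g = h then 2 ^ m else 0)"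
  proof (cases "g = h")
    case True
    then have "gmul g h = gid m" using assms by (simp add: gmul_eq_gid)
    then show ?thesis using True by (simp add: char_gid)
  qed (use sum_chars_nontrivial[of "gmul g h" m] assms in \<open>simp add: gmul_eq_gid\<close>)
  finally show ?thesis .
qed

section \<open>Pauli operators\<close>

lemma mat2_eqI:
  assumes "A \<in> carrier_mat 2 2" "B \<in> carrier_mat 2 2"
    "A $$ (0,0) = B $$ (0,0)" "A $$ (0,1) = B $$ (0,1)" "A $$ (1,0) = B $$ (1,0)" "A $$ (1,1) = B $$ (1,1)"
  shows "A = B"
proof (rule eq_matI)
  fix i j assume "i < dim_row B" "j < dim_col B"
  then have "i \<in> {0,1}" "j \<in> {0,1}" using assms by auto
  then show "A $$ (i, j) = B $$ (i, j)" using assms by auto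
qed (use assms in auto)

lemma pauli1_carrier [simp]: "pauli1 p \<in> carrier_mat 2 2" "dim_row (pauli1 p) = 2" "dim_col (pauli1 p) = 2"
  unfolding pauli1_def by (auto simp: mat_of_rows_list_def)

lemma pauli1_entries:
  "pauli1 p $$ (0,0) = (if p = 0 then 1 else if p = 1 \<or> p = 2 then 0 else 1)"
  "pauli1 p $$ (0,Suc 0) = (if p = 1 then 1 else if p = 2 then -\<i> else 0)"
  "pauli1 p $$ (Suc 0,0) = (if p = 1 then 1 else if p = 2 then \<i> else 0)"
  "pauli1 p $$ (Suc 0,Suc 0) = (if p = 0 then 1 else if p = 1 \<or> p = 2 then 0 else -1)"
  unfolding pauli1_def by (auto simp: mat_of_rows_list_def)

lemma sum_lessThan_2: "(\<Sum>l<2. f l) = f 0 + f (Suc 0)" for f :: "nat \<Rightarrow> complex"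
  by (simp add: numeral_2_eq_2)

lemma pauli1_square: "pauli1 p * pauli1 p = 1\<^sub>m 2"
  by (rule mat2_eqI)
    (auto simp: mult_index sum_lessThan_2 pauli1_entries simp del: index_mult_mat(1))

lemma pauli1_adj: "adj (pauli1 p) = pauli1 p"
  by (rule mat2_eqI) (auto simp: pauli1_entries)

lemma mtrace_pauli1: "mtrace (pauli1 p) = (if p = 0 then 2 else 0)"
  by (simp add: mtrace_def sum_lessThan_2 pauli1_entries)

text \<open>The minimum with 3 appears because \<open>pauli1\<close> reads every index above 2 as Z,
  so the statement covers all naturals.\<close>

lemma pauli1_commute:
  "pauli1 p * pauli1 q =
    (if p = 0 \<or> q = 0 \<or> min p 3 = min q 3 then 1 else -1) \<cdot>\<^sub>m (pauli1 q * pauli1 p)"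
  by (rule mat2_eqI)
    (auto simp: mult_index sum_lessThan_2 pauli1_entries min_def simp del: index_mult_mat(1))

lemma pauli_string_carrier [simp]: "pauli_string os \<in> carrier_mat (2 ^ length os) (2 ^ length os)"
  by (induction os) (auto intro!: kron_carrier)

lemma pauli_string_square: "pauli_string os * pauli_string os = 1\<^sub>m (2 ^ length os)"
proof (induction os)
  case (Cons p os)
  then show ?case
    by (simp add: kron_mult[OF pauli1_carrier(1) pauli_string_carrier pauli1_carrier(1) pauli_string_carrier]
        pauli1_square kron_one)
qed simp

lemma pauli_string_adj: "adj (pauli_string os) = pauli_string os"
  by (induction os) (auto simp: adj_kron pauli1_adj)

text \<open>The signs of the tensor factors multiply.\<close>

lemma pauli_string_commute:
  "length os = length ps \<Longrightarrow>
   \<exists>s\<in>{1, -1}. pauli_string os * pauli_string ps = s \<cdot>\<^sub>m (pauli_string ps * pauli_string os)"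
proof (induction os ps rule: list_induct2)
  case Nil
  show ?case by (intro bexI[of _ 1]) auto
next
  case (Cons p os q ps)
  then obtain s where s: "s \<in> {1,-1}"
    "pauli_string os * pauli_string ps = s \<cdot>\<^sub>m (pauli_string ps * pauli_string os)" by blast
  define t :: complex where "t = (if p = 0 \<or> q = 0 \<or> min p 3 = min q 3 then 1 else -1)"
  have c: "pauli_string ps \<in> carrier_mat (2 ^ length os) (2 ^ length os)"
    using Cons.hyps pauli_string_carrier[of ps] by simp
  note km = kron_mult[OF pauli1_carrier(1) _ pauli1_carrier(1)]
  have "pauli_string (p # os) * pauli_string (q # ps)
      = kron (pauli1 p * pauli1 q) (pauli_string os * pauli_string ps)"
    using km[OF pauli_string_carrier c] by simp
  also have "\<dots> = (t * s) \<cdot>\<^sub>m kron (pauli1 q * pauli1 p) (pauli_string ps * pauli_string os)"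
    unfolding s(2) pauli1_commute[of p q] t_def[symmetric] by (rule kron_smult)
  also have "kron (pauli1 q * pauli1 p) (pauli_string ps * pauli_string os)
      = pauli_string (q # ps) * pauli_string (p # os)"
    using km[OF c pauli_string_carrier] by simp
  finally show ?case using s(1) t_def by (intro bexI[of _ "t * s"]) auto
qed

text \<open>The trace is multiplicative over tensor factors, and X, Y and Z are traceless, so one
  nontrivial letter makes it vanish.\<close>

lemma pauli_string_trivial_or_traceless:
  "pauli_string os = 1\<^sub>m (2 ^ length os) \<or> mtrace (pauli_string os) = 0"
proof (induction os)
  case (Cons p os)
  have tr: "mtrace (pauli_string (p # os)) = mtrace (pauli1 p) * mtrace (pauli_string os)"
    by (simp add: mtrace_kron[OF pauli1_carrier(1) pauli_string_carrier])
  show ?case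
  proof (cases "p = 0")
    case True
    then show ?thesis using Cons tr by (auto simp: pauli1_def kron_one)
  next
    case False
    then show ?thesis using tr by (simp add: mtrace_pauli1)
  qed
qed simp

lemma i_power_cnj: "cnj (\<i> ^ l) * \<i> ^ l = 1" "\<i> ^ l * cnj (\<i> ^ l) = 1"
  by (simp_all flip: power_mult_distrib)

lemma pauli_group_unitary:
  assumes "E \<in> pauli_group n"
  shows "unitary_mat (2 ^ n) E"
proof -
  obtain l os where E: "E = (\<i> ^ l) \<cdot>\<^sub>m pauli_string os" and os: "length os = n"
    using assms unfolding pauli_group_def by auto
  have S: "pauli_string os \<in> carrier_mat (2 ^ n) (2 ^ n)" using os pauli_string_carrier[of os] by simp
  have "E * adj E = (\<i> ^ l * cnj (\<i> ^ l)) \<cdot>\<^sub>m (pauli_string os * pauli_string os)"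
    "adj E * E = (cnj (\<i> ^ l) * \<i> ^ l) \<cdot>\<^sub>m (pauli_string os * pauli_string os)"
    unfolding E adj_smult pauli_string_adj
    using S by (auto simp: mult_smult_distrib[of _ "2^n" "2^n"] mult_smult_assoc_mat[of _ "2^n" "2^n"]
        mult.commute simp del: complex_cnj_power)
  then show ?thesis
    unfolding unitary_mat_def i_power_cnj pauli_string_square using S E os by simp
qed

lemma pauli_group_commute:
  assumes "E \<in> pauli_group n" "F \<in> pauli_group n"
  shows "\<exists>s\<in>{1, -1}. E * F = s \<cdot>\<^sub>m (F * E)"
proof -
  obtain l os where E: "E = (\<i> ^ l) \<cdot>\<^sub>m pauli_string os" and os: "length os = n"
    using assms unfolding pauli_group_def by auto
  obtain m ps where F: "F = (\<i> ^ m) \<cdot>\<^sub>m pauli_string ps" and ps: "length ps = n"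
    using assms unfolding pauli_group_def by auto
  obtain s where s: "s \<in> {1,-1}"
    "pauli_string os * pauli_string ps = s \<cdot>\<^sub>m (pauli_string ps * pauli_string os)"
    using pauli_string_commute[of os ps] os ps by metis
  have c: "pauli_string os \<in> carrier_mat (2 ^ n) (2 ^ n)" "pauli_string ps \<in> carrier_mat (2 ^ n) (2 ^ n)"
    using os ps pauli_string_carrier by metis+
  have "E * F = (\<i> ^ l * \<i> ^ m) \<cdot>\<^sub>m (pauli_string os * pauli_string ps)"
    unfolding E F using c by (auto simp: mult_smult_distrib[of _ "2^n" "2^n"] mult_smult_assoc_mat[of _ "2^n" "2^n"])
  also have "\<dots> = s \<cdot>\<^sub>m ((\<i> ^ l * \<i> ^ m) \<cdot>\<^sub>m (pauli_string ps * pauli_string os))"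
    unfolding s(2) by (simp add: mult.commute)
  also have "(\<i> ^ l * \<i> ^ m) \<cdot>\<^sub>m (pauli_string ps * pauli_string os) = F * E"
    unfolding E F using c by (auto simp: mult_smult_distrib[of _ "2^n" "2^n"] mult_smult_assoc_mat[of _ "2^n" "2^n"] mult.commute)
  finally show ?thesis using s(1) by blast
qed

lemma pauli_group_scalar_or_traceless:
  assumes "E \<in> pauli_group n"
  shows "(\<exists>c. E = c \<cdot>\<^sub>m 1\<^sub>m (2 ^ n)) \<or> mtrace E = 0"
proof -
  obtain l os where E: "E = (\<i> ^ l) \<cdot>\<^sub>m pauli_string os" and os: "length os = n"
    using assms unfolding pauli_group_def by auto
  have "mtrace E = \<i> ^ l * mtrace (pauli_string os)"
    unfolding E by (rule mtrace_smult[OF pauli_string_carrier])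
  then show ?thesis using pauli_string_trivial_or_traceless[of os] E os by auto
qed

section \<open>Spans and generated algebras\<close>

lemma mspan_superset: "S \<subseteq> carrier_mat N N \<Longrightarrow> X \<in> S \<Longrightarrow> X \<in> mspan N S"
  using mspan.add[OF mspan.zero, of X S 1 N] by auto

lemma mspan_closed:
  assumes "A \<in> mspan N S" "S \<subseteq> T" "0\<^sub>m N N \<in> T"
    "\<And>A B. A \<in> T \<Longrightarrow> B \<in> T \<Longrightarrow> A + B \<in> T" "\<And>c A. A \<in> T \<Longrightarrow> c \<cdot>\<^sub>m A \<in> T"
  shows "A \<in> T"
  using assms by (induction rule: mspan.induct) auto

lemma star_alg_closed:
  assumes "A \<in> star_alg N S" "S \<subseteq> T" "1\<^sub>m N \<in> T"
    "\<And>A B. A \<in> T \<Longrightarrow> B \<in> T \<Longrightarrow> A + B \<in> T" "\<And>A B. A \<in> T \<Longrightarrow> B \<in> T \<Longrightarrow> A * B \<in> T"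
    "\<And>c A. A \<in> T \<Longrightarrow> c \<cdot>\<^sub>m A \<in> T" "\<And>A. A \<in> T \<Longrightarrow> adj A \<in> T"
  shows "A \<in> T"
  using assms by (induction rule: star_alg.induct) auto

lemma zero_in_star_alg: "0\<^sub>m N N \<in> star_alg N S"
proof -
  have "0 \<cdot>\<^sub>m 1\<^sub>m N = (0\<^sub>m N N :: complex mat)" by (rule eq_matI) auto
  then show ?thesis using star_alg.smult[OF star_alg.one, of 0 N S] by simp
qed

lemma mspan_subset_star_alg: "mspan N S \<subseteq> star_alg N S"
proof
  fix A assume "A \<in> mspan N S"
  then show "A \<in> star_alg N S"
    by (rule mspan_closed) (auto intro: star_alg.intros zero_in_star_alg)
qed

text \<open>Linear combinations of generators lie in the generated algebra, so the algebra sees the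
  generators only through their span. Since equivalence of error sets is equality of spans, this is
  claim (i).\<close>

lemma star_alg_mspan_eq:
  assumes "mspan N S = mspan N T" "S \<subseteq> carrier_mat N N" "T \<subseteq> carrier_mat N N"
  shows "star_alg N S = star_alg N T"
proof -
  have sub: "star_alg N S \<subseteq> star_alg N T"
    if "mspan N S = mspan N T" "S \<subseteq> carrier_mat N N" for S T
  proof
    fix A assume "A \<in> star_alg N S"
    then show "A \<in> star_alg N T"
    proof (rule star_alg_closed)
      show "S \<subseteq> star_alg N T" using mspan_superset[OF that(2)] that(1) mspan_subset_star_alg by blast
    qed (auto intro: star_alg.intros)
  qed
  show ?thesis using sub[of S T] sub[of T S] assms by blast
qed

section \<open>Matrix units\<close>

definition mat_unit :: "nat \<Rightarrow> nat \<Rightarrow> nat \<Rightarrow> complex mat" where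
  "mat_unit d a b = mat d d (\<lambda>(i, j). if i = a \<and> j = b then 1 else 0)"

lemma mat_unit_carrier [simp]: "mat_unit d a b \<in> carrier_mat d d"
  "dim_row (mat_unit d a b) = d" "dim_col (mat_unit d a b) = d"
  unfolding mat_unit_def by auto

lemma mat_unit_index [simp]:
  "i < d \<Longrightarrow> j < d \<Longrightarrow> mat_unit d a b $$ (i, j) = (if i = a \<and> j = b then 1 else 0)"
  unfolding mat_unit_def by simp

lemma mat_unit_induct:
  assumes M: "M \<in> carrier_mat d d" and zero: "Q (0\<^sub>m d d)"
    and add: "\<And>A B. A \<in> carrier_mat d d \<Longrightarrow> B \<in> carrier_mat d d \<Longrightarrow> Q A \<Longrightarrow> Q B \<Longrightarrow> Q (A + B)"
    and unit: "\<And>a b c. a < d \<Longrightarrow> b < d \<Longrightarrow> Q (c \<cdot>\<^sub>m mat_unit d a b)"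
  shows "Q M"
proof -
  \<comment> \<open>Entries outside \<open>T\<close> are set to 0, and \<open>T\<close> grows by one
    position at a time until it contains them all.\<close>
  have "Q (mat d d (\<lambda>ij. if ij \<in> T then M $$ ij else 0))"
    if "finite T" "T \<subseteq> {..<d} \<times> {..<d}" for T
    using that
  proof (induction T rule: finite_induct)
    case empty
    then show ?case using zero by (simp add: zero_mat_def)
  next
    case (insert x T)
    obtain a b where x: "x = (a, b)" "a < d" "b < d" using insert by auto
    have "mat d d (\<lambda>ij. if ij \<in> insert x T then M $$ ij else 0)
        = mat d d (\<lambda>ij. if ij \<in> T then M $$ ij else 0) + M $$ (a, b) \<cdot>\<^sub>m mat_unit d a b"
      using insert x by (intro eq_matI) auto
    then show ?case using insert x by (simp add: add unit)
  qed
  from this[of "{..<d} \<times> {..<d}"] have "Q (mat d d (\<lambda>ij. if ij \<in> {..<d} \<times> {..<d} then M $$ ij else 0))"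
    by simp
  moreover have "mat d d (\<lambda>ij. if ij \<in> {..<d} \<times> {..<d} then M $$ ij else 0) = M"
    using M by (intro eq_matI) auto
  ultimately show ?thesis by simp
qed

section \<open>Tensor factorizations\<close>

text \<open>The encoding of an identification of the N-dimensional space with a tensor product. It
  serves both directions: once with the \<open>W\<close> assembled from syndromes, once with the
  \<open>W\<close> that is given.\<close>

locale tensor_factorization =
  fixes N d K :: nat and W :: "complex mat"
  assumes W: "unitary_mat N W" and N: "N = d * K" and d_pos: "d > 0" and K_pos: "K > 0"
begin

definition emb :: "complex mat \<Rightarrow> complex mat" where
  "emb a = W * kron a (1\<^sub>m K) * adj W"

definition emb' :: "complex mat \<Rightarrow> complex mat" where
  "emb' b = W * kron (1\<^sub>m d) b * adj W"

lemma W_carrier [simp]: "W \<in> carrier_mat N N" and WW: "W * adj W = 1\<^sub>m N" "adj W * W = 1\<^sub>m N"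
  using unitary_matD[OF W] by auto

lemma kron_one_carrier [simp]: "a \<in> carrier_mat d d \<Longrightarrow> kron a (1\<^sub>m K) \<in> carrier_mat N N"
  unfolding N by simp

lemma kron_one_carrier' [simp]: "b \<in> carrier_mat K K \<Longrightarrow> kron (1\<^sub>m d) b \<in> carrier_mat N N"
  unfolding N by simp

lemma emb_carrier [simp]: "a \<in> carrier_mat d d \<Longrightarrow> emb a \<in> carrier_mat N N"
  unfolding emb_def by simp

lemma conj_mult:
  assumes "A \<in> carrier_mat N N" "B \<in> carrier_mat N N"
  shows "(W * A * adj W) * (W * B * adj W) = W * (A * B) * adj W"
proof -
  have "(W * A * adj W) * (W * B * adj W) = W * A * (adj W * W) * B * adj W"
    using assms by (simp add: assoc_mult_mat[of _ N N _ N _ N])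
  then show ?thesis using assms by (simp add: WW assoc_mult_mat[of _ N N _ N _ N])
qed

lemma conj_cancel:
  assumes "A \<in> carrier_mat N N"
  shows "adj W * (W * A * adj W) * W = A" "W * (adj W * A * W) * adj W = A"
proof -
  have "adj W * (W * A * adj W) * W = (adj W * W) * A * (adj W * W)"
    "W * (adj W * A * W) * adj W = (W * adj W) * A * (W * adj W)"
    using assms by (simp_all add: assoc_mult_mat[of _ N N _ N _ N])
  then show "adj W * (W * A * adj W) * W = A" "W * (adj W * A * W) * adj W = A"
    using assms by (simp_all add: WW)
qed

text \<open>The right-hand form can be compared column by column, which suits a \<open>W\<close>
  that is known through its columns.\<close>

lemma conj_iff:
  assumes "A \<in> carrier_mat N N" "B \<in> carrier_mat N N"
  shows "W * A * adj W = B \<longleftrightarrow> W * A = B * W"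
proof
  assume "W * A * adj W = B"
  then have "B * W = W * A * (adj W * W)"
    using assms by (auto simp: assoc_mult_mat[of _ N N _ N _ N])
  then show "W * A = B * W" using assms by (simp add: WW)
next
  assume "W * A = B * W"
  then have "W * A * adj W = B * (W * adj W)"
    using assms by (simp add: assoc_mult_mat[of _ N N _ N _ N])
  then show "W * A * adj W = B" using assms by (simp add: WW)
qed

lemma emb_mult: "a \<in> carrier_mat d d \<Longrightarrow> b \<in> carrier_mat d d \<Longrightarrow> emb (a * b) = emb a * emb b"
  unfolding emb_def by (simp add: conj_mult kron_mult[of _ d d _ K K _ d _ K])

lemma emb_adj:
  assumes "a \<in> carrier_mat d d" shows "emb (adj a) = adj (emb a)"
proof -
  have "adj (emb a) = W * (adj (kron a (1\<^sub>m K)) * adj W)"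
    using assms unfolding emb_def by (simp add: adj_mult[of _ N N _ N])
  then show ?thesis using assms unfolding emb_def
    by (simp add: adj_kron assoc_mult_mat[of _ N N _ N _ N])
qed

lemma emb_add:
  assumes "a \<in> carrier_mat d d" "b \<in> carrier_mat d d" shows "emb (a + b) = emb a + emb b"
  using assms unfolding emb_def
  by (simp add: kron_add_left[of _ d d] mult_add_distrib_mat[of _ N N _ N] add_mult_distrib_mat[of _ N N _ _ N])

lemma emb_smult: "a \<in> carrier_mat d d \<Longrightarrow> emb (c \<cdot>\<^sub>m a) = c \<cdot>\<^sub>m emb a"
  unfolding emb_def
  by (simp add: kron_smult_left mult_smult_distrib[of _ N N _ N] mult_smult_assoc_mat[of _ N N _ N])

lemma emb_one: "emb (1\<^sub>m d) = 1\<^sub>m N"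
  unfolding emb_def kron_one N[symmetric] by (simp add: WW)

lemma emb_zero: "emb (0\<^sub>m d d) = 0\<^sub>m N N"
proof -
  have "emb (0 \<cdot>\<^sub>m 0\<^sub>m d d) = 0 \<cdot>\<^sub>m emb (0\<^sub>m d d)" by (rule emb_smult) simp
  moreover have "0 \<cdot>\<^sub>m X = 0\<^sub>m N N" if "X \<in> carrier_mat N N" for X :: "complex mat"
    using that by (intro eq_matI) auto
  from this[OF emb_carrier] have "0 \<cdot>\<^sub>m emb (0\<^sub>m d d) = 0\<^sub>m N N" by simp
  ultimately show ?thesis by simp
qed

text \<open>With this, operator identities about \<open>U g\<close> and the code projector pull back
  to the frame factor.\<close>

lemma emb_inject:
  assumes "a \<in> carrier_mat d d" "b \<in> carrier_mat d d" shows "emb a = emb b \<longleftrightarrow> a = b"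
proof
  assume "emb a = emb b"
  then have "kron a (1\<^sub>m K) = kron b (1\<^sub>m K)"
    using conj_cancel(1)[OF kron_one_carrier] assms unfolding emb_def by metis
  then show "a = b" using kron_one_right_inject assms K_pos by blast
qed simp

lemma mtrace_emb:
  assumes "a \<in> carrier_mat d d" shows "mtrace (emb a) = mtrace a * of_nat K"
proof -
  have "mtrace (emb a) = mtrace (adj W * (W * kron a (1\<^sub>m K)))"
    unfolding emb_def by (rule mtrace_comm[of _ N N]) (use assms in auto)
  also have "adj W * (W * kron a (1\<^sub>m K)) = adj W * W * kron a (1\<^sub>m K)"
    using assms by (simp add: assoc_mult_mat[of _ N N _ N _ N])
  also have "mtrace \<dots> = mtrace a * of_nat K"
    using assms by (simp add: WW mtrace_kron[of _ d _ K])
  finally show ?thesis .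
qed

lemma emb_avg_mat:
  assumes "\<And>g. g \<in> G \<Longrightarrow> f g \<in> carrier_mat d d"
  shows "emb (avg_mat d G f) = avg_mat N G (\<lambda>g. emb (f g))"
  unfolding emb_def using assms
  by (simp add: kron_avg_mat[where K = K] N[symmetric] mult_avg_mat avg_mat_mult)

text \<open>The identity factor keeps only those indices whose remainder modulo K is that of
  \<open>j\<close>.\<close>

lemma mult_kron_one_index:
  assumes "X \<in> carrier_mat r N" "a \<in> carrier_mat d d" "i < r" "j < N"
  shows "(X * kron a (1\<^sub>m K)) $$ (i, j) = (\<Sum>l<d. X $$ (i, l * K + j mod K) * a $$ (l, j div K))"
proof -
  have "(X * kron a (1\<^sub>m K)) $$ (i, j) = (\<Sum>l<d*K. X $$ (i, l) * kron a (1\<^sub>m K) $$ (l, j))"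
    using assms N by (auto simp: mult_index simp del: index_mult_mat(1))
  also have "\<dots> = (\<Sum>l<d. \<Sum>y<K. X $$ (i, l * K + y) * kron a (1\<^sub>m K) $$ (l * K + y, j))"
    by (rule sum_lessThan_mult)
  also have "\<dots> = (\<Sum>l<d. \<Sum>y<K. if y = j mod K then X $$ (i, l * K + y) * a $$ (l, j div K) else 0)"
    using assms N K_pos by (intro sum.cong) (auto simp: kron_index pair_index_less)
  also have "\<dots> = (\<Sum>l<d. X $$ (i, l * K + j mod K) * a $$ (l, j div K))"
    using K_pos by simp
  finally show ?thesis .
qed

lemma kron_one_mult_index:
  assumes X: "X \<in> carrier_mat N r" and a: "a \<in> carrier_mat d d" and "i < N" "j < r"
  shows "(kron a (1\<^sub>m K) * X) $$ (i, j) = (\<Sum>l<d. a $$ (i div K, l) * X $$ (l * K + i mod K, j))"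
proof -
  have c: "kron a (1\<^sub>m K) \<in> carrier_mat N N" using a by simp
  have lt: "l * K + i mod K < N" if "l < d" for l
    using pair_index_less[OF that, of "i mod K" K] K_pos N by simp
  have id: "i div K < d" using assms N by (simp add: less_mult_imp_div_less)
  have "(kron a (1\<^sub>m K) * X) $$ (i, j) = cnj (adj (kron a (1\<^sub>m K) * X) $$ (j, i))"
    using c X assms N by (subst adj_index) auto
  also have "adj (kron a (1\<^sub>m K) * X) = adj X * kron (adj a) (1\<^sub>m K)"
    using c X by (simp add: adj_mult[of _ N N _ r] adj_kron)
  also have "(adj X * kron (adj a) (1\<^sub>m K)) $$ (j, i)
      = (\<Sum>l<d. adj X $$ (j, l * K + i mod K) * adj a $$ (l, i div K))"
    by (rule mult_kron_one_index) (use assms in auto)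
  finally show ?thesis using assms lt id by (simp add: mult.commute)
qed

text \<open>Commuting with the matrix units \<open>e\<^sub>0\<^sub>r \<otimes> I\<close> already forces \<open>B = I \<otimes> b\<close>.\<close>

lemma commutant_emb:
  "commutant N {emb a |a. a \<in> carrier_mat d d} = {emb' b |b. b \<in> carrier_mat K K}"
proof (intro equalityI subsetI)
  fix B assume "B \<in> {emb' b |b. b \<in> carrier_mat K K}"
  then obtain b where b: "b \<in> carrier_mat K K" "B = emb' b" by auto
  have "emb a * B = B * emb a" if "a \<in> carrier_mat d d" for a
    unfolding emb_def b(2) emb'_def using that b
    by (simp add: conj_mult kron_mult[of _ d d _ K K _ d _ K])
  then show "B \<in> commutant N {emb a |a. a \<in> carrier_mat d d}"
    using b unfolding commutant_def emb'_def by auto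
next
  fix B assume B: "B \<in> commutant N {emb a |a. a \<in> carrier_mat d d}"
  then have Bc: "B \<in> carrier_mat N N" unfolding commutant_def by auto
  define B' where "B' = adj W * B * W"
  have B'c: "B' \<in> carrier_mat N N" unfolding B'_def using Bc by simp
  have BB': "B = W * B' * adj W" unfolding B'_def using conj_cancel(2)[OF Bc] by simp
  have comm: "kron a (1\<^sub>m K) * B' = B' * kron a (1\<^sub>m K)" if a: "a \<in> carrier_mat d d" for a
  proof -
    have "emb a * B = B * emb a" using B a unfolding commutant_def by auto
    then have "W * (kron a (1\<^sub>m K) * B') * adj W = W * (B' * kron a (1\<^sub>m K)) * adj W"
      unfolding emb_def BB' using a B'c by (simp add: conj_mult)
    then show ?thesis
      by (metis conj_cancel(1) mult_square_carrier kron_one_carrier a B'c)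
  qed
  \<comment> \<open>The top left K by K block; every diagonal block will turn out to be a copy of
    it.\<close>
  define b where "b = mat K K (\<lambda>(i, j). B' $$ (i, j))"
  have "B' = kron (1\<^sub>m d) b"
  proof (rule eq_matI)
    fix i j assume "i < dim_row (kron (1\<^sub>m d) b)" "j < dim_col (kron (1\<^sub>m d) b)"
    then have ij: "i < N" "j < N" using N b_def by auto
    have ij': "i div K < d" "j div K < d" "i mod K < K" "j mod K < K"
      using ij N K_pos by (auto simp: less_mult_imp_div_less)
    have lt: "i mod K < N" using pair_index_less[of 0 d "i mod K" K] d_pos ij' N by simp
    \<comment> \<open>In row \<open>i mod K\<close>, left multiplication by this unit fetches the
      entry (i, j) of \<open>B'\<close>, while right multiplication vanishes outside block column
      \<open>i div K\<close> and reads the top left block inside it.\<close>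
    let ?u = "mat_unit d 0 (i div K)"
    have "(kron ?u (1\<^sub>m K) * B') $$ (i mod K, j) = B' $$ (i, j)"
      using ij ij' lt d_pos by (simp add: kron_one_mult_index[OF B'c] if_distrib[of "\<lambda>x. x * _"] cong: if_cong)
    moreover have "(B' * kron ?u (1\<^sub>m K)) $$ (i mod K, j) = (if j div K = i div K then B' $$ (i mod K, j mod K) else 0)"
      using ij ij' lt d_pos by (simp add: mult_kron_one_index[OF B'c] if_distrib[of "\<lambda>x. _ * x"] cong: if_cong)
    ultimately have "B' $$ (i, j) = (if j div K = i div K then B' $$ (i mod K, j mod K) else 0)"
      using comm[of ?u] by simp
    then show "B' $$ (i, j) = kron (1\<^sub>m d) b $$ (i, j)"
      using ij ij' N unfolding b_def by (auto simp: kron_index)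
  qed (use B'c N b_def in auto)
  then have "B = emb' b" using BB' unfolding emb'_def by simp
  then show "B \<in> {emb' b |b. b \<in> carrier_mat K K}" unfolding b_def by auto
qed

end

section \<open>The code projector\<close>

locale stabilizer_code =
  fixes n k :: nat and U :: "bool list \<Rightarrow> complex mat"
  assumes k_less: "k < n" and stab: "stab_rep n k U"
begin

abbreviation "N \<equiv> (2 :: nat) ^ n"
abbreviation "d \<equiv> (2 :: nat) ^ (n - k)"
abbreviation "K \<equiv> (2 :: nat) ^ k"
abbreviation "G \<equiv> Zgrp (n - k)"
abbreviation "P \<equiv> proj_pn n k U"

lemma N_eq: "N = d * K"
  using k_less by (simp flip: power_add)

lemma U_pauli: "g \<in> G \<Longrightarrow> U g \<in> pauli_group n"
  and U_gmul: "g \<in> G \<Longrightarrow> h \<in> G \<Longrightarrow> U (gmul g h) = U g * U h"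
  and U_inj: "inj_on U G" and minus_one_notin: "- 1\<^sub>m N \<notin> U ` G"
  using stab unfolding stab_rep_def by auto

lemma U_unitary: "g \<in> G \<Longrightarrow> unitary_mat N (U g)"
  using U_pauli pauli_group_unitary by blast

lemma U_carrier [simp]: "g \<in> G \<Longrightarrow> U g \<in> carrier_mat N N"
  using U_unitary unitary_matD by blast

text \<open>The product law makes this operator idempotent, and an idempotent unitary is the
  identity.\<close>

lemma U_gid: "U (gid (n - k)) = 1\<^sub>m N"
proof -
  let ?u = "U (gid (n - k))"
  have "?u = ?u * ?u" using U_gmul[of "gid (n-k)" "gid (n-k)"] by simp
  then have "adj ?u * ?u = (adj ?u * ?u) * ?u"
    using assoc_mult_mat[of "adj ?u" N N ?u N ?u N] by simp
  then show ?thesis using unitary_matD[OF U_unitary, of "gid (n-k)"] by simp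
qed

lemma U_square: "g \<in> G \<Longrightarrow> U g * U g = 1\<^sub>m N"
  using U_gmul[of g g] gmul_eq_gid[of g "n - k" g] U_gid by simp

lemma U_adj: assumes g: "g \<in> G" shows "adj (U g) = U g"
proof -
  have "adj (U g) = adj (U g) * (U g * U g)" using g by (simp add: U_square)
  also have "\<dots> = (adj (U g) * U g) * U g" using g assoc_mult_mat[of "adj (U g)" N N "U g" N "U g" N] by simp
  finally show ?thesis using unitary_matD[OF U_unitary[OF g]] by simp
qed

text \<open>A Pauli operator of nonzero trace is a scalar, and as an involution it is I or -I.
  Faithfulness excludes I, and -I is excluded by assumption.\<close>

lemma U_traceless:
  assumes g: "g \<in> G" "g \<noteq> gid (n - k)"
  shows "mtrace (U g) = 0"
proof (rule ccontr)
  assume "mtrace (U g) \<noteq> 0"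
  then obtain c where c: "U g = c \<cdot>\<^sub>m 1\<^sub>m N" using pauli_group_scalar_or_traceless[OF U_pauli[OF g(1)]] by auto
  have "(c * c) \<cdot>\<^sub>m 1\<^sub>m N = (1 :: complex) \<cdot>\<^sub>m 1\<^sub>m N"
    using U_square[OF g(1)] unfolding c by (simp add: mult_smult_distrib[of _ N N _ N] mult_smult_assoc_mat[of _ N N _ N])
  then have "((c * c) \<cdot>\<^sub>m 1\<^sub>m N) $$ (0, 0) = ((1 :: complex) \<cdot>\<^sub>m 1\<^sub>m N) $$ (0, 0)" by simp
  then have "c * c = 1" by simp
  then have "c = 1 \<or> c = -1" by (simp add: square_eq_1_iff)
  then show False
  proof
    assume "c = 1"
    then have "U g = U (gid (n - k))" using c U_gid by simp
    then show False using U_inj g by (auto dest: inj_onD)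
  next
    assume "c = -1"
    then have "U g = - 1\<^sub>m N" using c by (auto intro!: eq_matI)
    then show False using minus_one_notin g by (metis imageI)
  qed
qed

lemma P_avg: "P = avg_mat N G U"
  unfolding proj_pn_def avg_mat_def by simp

lemma P_carrier [simp]: "P \<in> carrier_mat N N"
  unfolding P_avg by simp

lemma U_mult_P: assumes "g \<in> G" shows "U g * P = P"
proof -
  have "U g * P = avg_mat N G (\<lambda>h. U (gmul g h))"
    unfolding P_avg using assms by (simp add: mult_avg_mat U_gmul cong: avg_mat_cong)
  then show ?thesis using avg_mat_gmul[OF assms, of N U] P_avg by simp
qed

lemma P_adj: "adj P = P"
  unfolding P_avg using adj_avg_mat[of G U N] U_adj by (simp cong: avg_mat_cong)

lemma P_mult_U: assumes "g \<in> G" shows "P * U g = P"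
proof -
  have "adj (P * U g) = U g * P" using assms by (simp add: adj_mult[of _ N N _ N] P_adj U_adj)
  then show ?thesis using U_mult_P[OF assms] P_adj by (metis adj_adj)
qed

lemma P_square: "P * P = P"
proof -
  have "P * P = avg_mat N G (\<lambda>g. U g * P)"
    by (subst (1) P_avg) (simp add: avg_mat_mult)
  also have "\<dots> = avg_mat N G (\<lambda>g. P)" by (rule avg_mat_cong) (rule U_mult_P)
  finally show ?thesis by (simp add: avg_mat_const)
qed

text \<open>Only the identity contributes to the trace of the average, which leaves 2^n /
  2^(n-k).\<close>

lemma mtrace_P: "mtrace P = of_nat K"
proof -
  have "(\<Sum>g\<in>G. mtrace (U g)) = (\<Sum>g\<in>G. if g = gid (n - k) then of_nat N else 0)"
    using U_traceless U_gid by (intro sum.cong) auto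
  then have "mtrace P = of_nat N / of_nat d"
    unfolding P_avg by (simp add: mtrace_avg_mat)
  then show ?thesis unfolding N_eq by simp
qed

lemma mrank_P: "mrank N P = K"
  and P_isometry: "\<exists>V. V \<in> carrier_mat N K \<and> adj V * V = 1\<^sub>m K \<and> P = V * adj V \<and> P * V = V"
  using projector_factorization[OF P_carrier P_adj P_square mtrace_P] by auto

lemma syndrome_count: "N div mrank N P = d"
  unfolding mrank_P by (simp add: N_eq)

lemma P_smult_cancel: assumes "a \<cdot>\<^sub>m P = b \<cdot>\<^sub>m P" shows "a = b"
proof -
  have "a * mtrace P = b * mtrace P"
    using assms mtrace_smult[OF P_carrier] by metis
  then show ?thesis using mtrace_P by simp
qed

text \<open>Errors enter the Knill-Laflamme condition only through the operators
  \<open>E * P\<close>, in the manner of a Gram matrix.\<close>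

lemma KL_product:
  assumes "E \<in> carrier_mat N N" "F \<in> carrier_mat N N"
  shows "P * adj E * F * P = adj (E * P) * (F * P)"
  using assms by (simp add: adj_mult[of _ N N _ N] P_adj assoc_mult_mat[of _ N N _ N _ N])

text \<open>The Knill-Laflamme matrix is then the identity of size d, whose rank is the required
  quotient of dimensions.\<close>

lemma max_correctable_orthonormal:
  assumes "length Es = d" "set Es \<subseteq> carrier_mat N N"
    and "\<And>i j. i < d \<Longrightarrow> j < d \<Longrightarrow>
      P * adj (Es ! i) * (Es ! j) * P = (if i = j then 1 else 0) \<cdot>\<^sub>m P"
  shows "max_correctable N P Es"
  unfolding max_correctable_def KL_matrix_def syndrome_count
  using assms by (auto intro!: exI[of _ "1\<^sub>m d"] simp: mrank_one)

end

section \<open>From a tensor factorization to an error class\<close>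

locale reference_frame = stabilizer_code n k U for n k U +
  fixes W :: "complex mat" and UR :: "bool list \<Rightarrow> complex mat"
  assumes W_unitary: "unitary_mat (2 ^ n) W"
    and UR_carrier [simp]: "\<And>g. g \<in> Zgrp (n - k) \<Longrightarrow> UR g \<in> carrier_mat (2 ^ (n - k)) (2 ^ (n - k))"
    and U_eq: "\<And>g. g \<in> Zgrp (n - k) \<Longrightarrow> U g = W * kron (UR g) (1\<^sub>m (2 ^ k)) * adj W"
begin

declare One_nat_def [simp del]

sublocale tensor_factorization N d K W
  using W_unitary N_eq by unfold_locales auto

lemma emb_UR: "g \<in> G \<Longrightarrow> emb (UR g) = U g"
  unfolding emb_def by (simp add: U_eq)

section \<open>The code projector seen in the frame factor\<close>

definition p :: "complex mat" where "p = avg_mat d G UR"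

lemma p_carrier [simp]: "p \<in> carrier_mat d d"
  unfolding p_def by simp

lemma emb_p: "emb p = P"
  unfolding p_def P_avg by (simp add: emb_avg_mat emb_UR cong: avg_mat_cong)

lemma p_square: "p * p = p"
  using emb_inject[of "p * p" p] by (simp add: emb_mult emb_p P_square)

lemma p_adj: "adj p = p"
  using emb_inject[of "adj p" p] by (simp add: emb_adj emb_p P_adj)

lemma mtrace_p: "mtrace p = of_nat 1"
  using mtrace_emb[of p] mtrace_P by (simp add: emb_p)

lemma UR_mult_p: "g \<in> G \<Longrightarrow> UR g * p = p"
  using emb_inject[of "UR g * p" p] by (simp add: emb_mult emb_p emb_UR U_mult_P)

lemma UR_square: "g \<in> G \<Longrightarrow> UR g * UR g = 1\<^sub>m d"
  using emb_inject[of "UR g * UR g" "1\<^sub>m d"] by (simp add: emb_mult emb_UR U_square emb_one)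

lemma UR_adj: "g \<in> G \<Longrightarrow> adj (UR g) = UR g"
  using emb_inject[of "adj (UR g)" "UR g"] by (simp add: emb_adj emb_UR U_adj)

text \<open>A unit vector spanning the range of \<open>p\<close>, fixed up to a phase, kept as a
  one-column matrix so that kets and bras are matrix products.\<close>

definition v :: "complex mat" where
  "v = (SOME v. v \<in> carrier_mat d 1 \<and> adj v * v = 1\<^sub>m 1 \<and> p = v * adj v \<and> p * v = v)"

lemma v_carrier [simp]: "v \<in> carrier_mat d 1"
  and v_unit: "adj v * v = 1\<^sub>m 1" and p_v: "p = v * adj v" and p_mult_v: "p * v = v"
  using someI_ex[OF projector_factorization(2)[OF p_carrier p_adj p_square mtrace_p]]
  unfolding v_def by auto

definition factors :: "complex mat \<Rightarrow> bool" where
  "factors E \<longleftrightarrow> (\<exists>e\<in>carrier_mat d d. E * P = emb e)"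

text \<open>This set does not mention any error set. It will be the span of every admissible maximal
  one, which is why the class is unique.\<close>

definition frame_errors :: "complex mat set" where
  "frame_errors = {emb (x * adj v) |x. x \<in> carrier_mat d 1}"

lemma ketbra_carrier [simp]: "x \<in> carrier_mat d 1 \<Longrightarrow> x * adj v \<in> carrier_mat d d"
  by (rule mult_carrier_mat[of _ d 1]) simp_all

lemma mult_v_carrier [simp]: "e \<in> carrier_mat d d \<Longrightarrow> e * v \<in> carrier_mat d 1"
  by (rule mult_carrier_mat[of _ d d]) simp_all

lemma ketbra_v: "e \<in> carrier_mat d d \<Longrightarrow> e * v * adj v = e * p"
  unfolding p_v by (rule assoc_mult_mat[of _ d d _ 1 _ d]) simp_all

text \<open>Absorbing a second code projector translates into the frame factor. As \<open>p\<close>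
  has rank one, \<open>e\<close> is determined by the single vector \<open>e * v\<close>.\<close>

lemma factor_mult_p:
  assumes E: "E \<in> carrier_mat N N" and e: "e \<in> carrier_mat d d" and eq: "E * P = emb e"
  shows "e * p = e"
proof -
  have "emb (e * p) = E * P * P" using e by (simp add: emb_mult emb_p eq)
  also have "\<dots> = E * P" using E by (simp add: assoc_mult_mat[of _ N N _ N _ N] P_square)
  finally show ?thesis using emb_inject[of "e * p" e] e eq by simp
qed

lemma factor_ketbra:
  assumes "E \<in> carrier_mat N N" "e \<in> carrier_mat d d" "E * P = emb e"
  shows "E * P = emb (e * v * adj v)"
  using factor_mult_p[OF assms] ketbra_v[OF assms(2)] assms(3) by simp

lemma frame_errors_add:
  assumes "A \<in> frame_errors" "B \<in> frame_errors" shows "A + B \<in> frame_errors"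
proof -
  obtain x y where x: "x \<in> carrier_mat d 1" "A = emb (x * adj v)"
    and y: "y \<in> carrier_mat d 1" "B = emb (y * adj v)" using assms unfolding frame_errors_def by auto
  have "(x + y) * adj v = x * adj v + y * adj v"
    by (rule add_mult_distrib_mat[of _ d 1 _ _ d]) (use x y in simp_all)
  then have "A + B = emb ((x + y) * adj v)" using x y by (simp add: emb_add)
  then show ?thesis unfolding frame_errors_def using x y by auto
qed

lemma frame_errors_smult:
  assumes "A \<in> frame_errors" shows "c \<cdot>\<^sub>m A \<in> frame_errors"
proof -
  obtain x where x: "x \<in> carrier_mat d 1" "A = emb (x * adj v)"
    using assms unfolding frame_errors_def by auto
  have "(c \<cdot>\<^sub>m x) * adj v = c \<cdot>\<^sub>m (x * adj v)"
    by (rule mult_smult_assoc_mat[of _ d 1 _ d]) (use x in simp_all)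
  then have "c \<cdot>\<^sub>m A = emb ((c \<cdot>\<^sub>m x) * adj v)" using x by (simp add: emb_smult)
  then show ?thesis unfolding frame_errors_def using x by auto
qed

lemma zero_in_frame_errors: "0\<^sub>m N N \<in> frame_errors"
proof -
  have "0\<^sub>m d 1 * adj v = 0\<^sub>m d d" by (rule left_mult_zero_mat) simp
  then show ?thesis unfolding frame_errors_def using emb_zero
    by (intro CollectI exI[of _ "0\<^sub>m d 1"]) auto
qed

text \<open>The Knill-Laflamme matrix is the Gram matrix of the vectors \<open>e\<^sub>j v\<close>, so maximal rank means
  that these vectors span \<open>\<complex>\<^sup>d\<close>: the span of the \<open>E\<^sub>j \<Pi>\<close> does not depend on the error set.\<close>

lemma mspan_max_correctable:
  assumes max: "max_correctable N P Es" and fac: "\<And>E. E \<in> set Es \<Longrightarrow> factors E"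
  shows "mspan N ((\<lambda>E. E * P) ` set Es) = frame_errors" (is "mspan N ?S = _")
proof (intro equalityI subsetI)
  have Ec: "E \<in> carrier_mat N N" if "E \<in> set Es" for E using max that unfolding max_correctable_def by auto
  have Sc: "?S \<subseteq> carrier_mat N N" using Ec by auto
  {
    fix A assume "A \<in> mspan N ?S"
    then show "A \<in> frame_errors"
    proof (rule mspan_closed)
      show "?S \<subseteq> frame_errors"
      proof
        fix X assume "X \<in> ?S"
        then obtain E where E: "E \<in> set Es" "X = E * P" by auto
        obtain e where e: "e \<in> carrier_mat d d" "E * P = emb e" using fac[OF E(1)] unfolding factors_def by auto
        show "X \<in> frame_errors"
          unfolding frame_errors_def E(2) using factor_ketbra[OF Ec[OF E(1)] e] e(1)
          by (intro CollectI exI[of _ "e * v"]) simp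
      qed
    qed (auto intro: zero_in_frame_errors frame_errors_add frame_errors_smult)
  }
  fix A assume "A \<in> frame_errors"
  then obtain x where x: "x \<in> carrier_mat d 1" "A = emb (x * adj v)" unfolding frame_errors_def by auto
  define m where "m = length Es"
  obtain C where KL: "KL_matrix N P Es C" and rk: "mrank m C = d"
    using max unfolding max_correctable_def syndrome_count m_def by auto
  have C: "C \<in> carrier_mat m m" using KL unfolding KL_matrix_def m_def by auto
  have "\<forall>j<m. \<exists>e. e \<in> carrier_mat d d \<and> Es ! j * P = emb e"
    using fac unfolding factors_def m_def by (metis nth_mem)
  then obtain e where e: "\<And>j. j < m \<Longrightarrow> e j \<in> carrier_mat d d" "\<And>j. j < m \<Longrightarrow> Es ! j * P = emb (e j)"
    by metis
  have Ej: "Es ! j \<in> carrier_mat N N" "Es ! j \<in> set Es" if "j < m" for j using Ec that m_def by auto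
  \<comment> \<open>Column j is the vector \<open>e j * v\<close>.\<close>
  define T where "T = mat d m (\<lambda>(a, j). (e j * v) $$ (a, 0))"
  have Tc: "T \<in> carrier_mat d m" unfolding T_def by simp
  have gram: "C = adj T * T"
  proof (rule eq_matI)
    fix i j assume "i < dim_row (adj T * T)" "j < dim_col (adj T * T)"
    then have ij: "i < m" "j < m" using Tc by auto
    have "emb (adj (e i) * e j) = adj (Es ! i * P) * (Es ! j * P)"
      using e ij by (simp add: emb_mult emb_adj)
    also have "\<dots> = C $$ (i, j) \<cdot>\<^sub>m P"
      using KL ij Ej KL_product unfolding KL_matrix_def m_def by auto
    also have "\<dots> = emb (C $$ (i, j) \<cdot>\<^sub>m p)" by (simp add: emb_smult emb_p)
    finally have "adj (e i) * e j = C $$ (i, j) \<cdot>\<^sub>m p" using emb_inject e ij by simp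
    \<comment> \<open>Applying both sides to \<open>v\<close> and pairing with \<open>v\<close>
      turns the operator identity into the scalar one.\<close>
    then have "adj (e i) * e j * v = C $$ (i, j) \<cdot>\<^sub>m v"
      using mult_smult_assoc_mat[OF p_carrier v_carrier] p_mult_v by simp
    moreover have "adj (e i) * e j * v = adj (e i) * (e j * v)"
      by (rule assoc_mult_mat[of _ d d _ d _ 1]) (use e ij in simp_all)
    moreover have "adj (e i * v) * (e j * v) = adj v * (adj (e i) * (e j * v))"
      using e ij by (subst adj_mult[of _ d d _ 1]) (auto intro!: assoc_mult_mat[of _ 1 d _ d _ 1])
    moreover have "adj v * (C $$ (i, j) \<cdot>\<^sub>m v) = C $$ (i, j) \<cdot>\<^sub>m (adj v * v)"
      by (rule mult_smult_distrib[of _ 1 d _ 1]) simp_all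
    ultimately have "adj (e i * v) * (e j * v) = C $$ (i, j) \<cdot>\<^sub>m 1\<^sub>m 1" by (simp add: v_unit)
    then have "(adj (e i * v) * (e j * v)) $$ (0, 0) = C $$ (i, j)" by simp
    moreover have "(adj (e i * v) * (e j * v)) $$ (0, 0) = (\<Sum>a<d. cnj ((e i * v) $$ (a, 0)) * (e j * v) $$ (a, 0))"
    proof -
      have c: "e i * v \<in> carrier_mat d 1" "e j * v \<in> carrier_mat d 1" using e ij by auto
      have "(adj A * B) $$ (0, 0) = (\<Sum>a<d. cnj (A $$ (a, 0)) * B $$ (a, 0))"
        if "A \<in> carrier_mat d 1" "B \<in> carrier_mat d 1" for A B
        using that by (simp add: mult_index del: index_mult_mat(1))
      from this[OF c] show ?thesis .
    qed
    moreover have "(adj T * T) $$ (i, j) = (\<Sum>a<d. cnj ((e i * v) $$ (a, 0)) * (e j * v) $$ (a, 0))"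
      using ij Tc by (simp add: mult_index T_def del: index_mult_mat(1))
    ultimately show "C $$ (i, j) = (adj T * T) $$ (i, j)" by simp
  qed (use C Tc in auto)
  obtain V Y where V: "V \<in> carrier_mat m d" "Y \<in> carrier_mat m d" "adj V * V = 1\<^sub>m d" "V = C * Y"
    using orthonormal_column_basis[OF C rk[symmetric]] by metis
  \<comment> \<open>Since \<open>V = C * Y\<close> and \<open>C = adj T * T\<close>, the square
    matrix \<open>T * Y\<close> has the left inverse \<open>adj V * adj T\<close>. This is also a
    right inverse, so \<open>T * Z\<close> is the identity and \<open>Z * x\<close> holds
    coefficients of \<open>x\<close> in the columns of \<open>T\<close>.\<close>
  define Z where "Z = Y * (adj V * adj T)"
  have Zc: "Z \<in> carrier_mat m d"
    unfolding Z_def using V(1,2) Tc by (intro mult_carrier_mat[of _ m d] mult_carrier_mat[of _ d m]) auto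
  have TY: "T * Y \<in> carrier_mat d d" using Tc V(2) by (rule mult_carrier_mat)
  have VT: "adj V * adj T \<in> carrier_mat d d" using adj_carrier[OF V(1)] adj_carrier[OF Tc] by (rule mult_carrier_mat)
  have "adj T * (T * Y) = V"
    using assoc_mult_mat[OF adj_carrier[OF Tc] Tc V(2)] gram V(4) by simp
  then have "(adj V * adj T) * (T * Y) = 1\<^sub>m d"
    using assoc_mult_mat[OF adj_carrier[OF V(1)] adj_carrier[OF Tc] TY] V(3) by simp
  from mat_mult_left_right_inverse[OF VT TY this]
  have TZ: "T * Z = 1\<^sub>m d"
    unfolding Z_def using assoc_mult_mat[OF Tc V(2) VT] by simp
  define z where "z = Z * x"
  have zc: "z \<in> carrier_mat m 1" unfolding z_def using Zc x(1) by (rule mult_carrier_mat)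
  have xz: "x = T * z" unfolding z_def using assoc_mult_mat[OF Tc Zc x(1)] TZ x(1) by simp
  \<comment> \<open>Partial sums of the expansion of \<open>x\<close>, because \<open>mspan\<close>
    adds one term at a time.\<close>
  define y where "y q = mat d 1 (\<lambda>(a, b). \<Sum>j<q. T $$ (a, j) * z $$ (j, 0))" for q
  have yc: "y q \<in> carrier_mat d 1" for q unfolding y_def by simp
  have "emb (y q * adj v) \<in> mspan N ?S" if "q \<le> m" for q
    using that
  proof (induction q)
    case 0
    have "y 0 = 0\<^sub>m d 1" unfolding y_def by (rule eq_matI) auto
    then have "y 0 * adj v = 0\<^sub>m d d" using left_mult_zero_mat[OF adj_carrier[OF v_carrier]] by simp
    then show ?case by (simp add: emb_zero mspan.zero)
  next
    case (Suc q)
    have q: "q < m" using Suc by simp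
    have eq: "e q * v \<in> carrier_mat d 1" using e q by simp
    have "y (Suc q) = z $$ (q, 0) \<cdot>\<^sub>m (e q * v) + y q"
      using q carrier_matD[OF e(1)[OF q]] carrier_matD[OF v_carrier]
      by (intro eq_matI) (auto simp: y_def T_def simp del: index_mult_mat(1))
    then have "y (Suc q) * adj v = z $$ (q, 0) \<cdot>\<^sub>m (e q * v) * adj v + y q * adj v"
      using add_mult_distrib_mat[of "z $$ (q, 0) \<cdot>\<^sub>m (e q * v)" d 1 "y q" "adj v" d] eq yc by simp
    also have "z $$ (q, 0) \<cdot>\<^sub>m (e q * v) * adj v = z $$ (q, 0) \<cdot>\<^sub>m (e q * v * adj v)"
      by (rule mult_smult_assoc_mat[OF eq adj_carrier[OF v_carrier]])
    finally have "emb (y (Suc q) * adj v) = z $$ (q, 0) \<cdot>\<^sub>m emb (e q * v * adj v) + emb (y q * adj v)"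
      using eq yc by (simp add: emb_add emb_smult)
    then have "emb (y (Suc q) * adj v) = z $$ (q, 0) \<cdot>\<^sub>m (Es ! q * P) + emb (y q * adj v)"
      using factor_ketbra[OF Ej(1)[OF q] e(1)[OF q] e(2)[OF q]] by simp
    then show ?case using Suc Ej(2)[OF q] by (auto intro!: mspan.add)
  qed
  moreover have "y m = x"
    unfolding xz using Tc zc by (intro eq_matI) (auto simp: y_def mult_index simp del: index_mult_mat(1))
  ultimately show "A \<in> mspan N ?S" using x(2) by auto
qed

text \<open>A representative that can be written down without a dual representation: the i-th error
  is the i-th standard basis vector times the bra of \<open>v\<close>. These operators need not be
  unitary.\<close>

definition basis_errors :: "complex mat list" where
  "basis_errors = map (\<lambda>i. emb (mat d 1 (\<lambda>(a, b). if a = i then 1 else 0) * adj v)) [0..<d]"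

lemma emb_mult_P: "e \<in> carrier_mat d d \<Longrightarrow> emb e * P = emb (e * p)"
  by (simp add: emb_mult emb_p)

lemma factors_emb: "e \<in> carrier_mat d d \<Longrightarrow> factors (emb e)"
  unfolding factors_def using emb_mult_P by (intro bexI[of _ "e * p"]) auto

lemma max_correctable_emb:
  assumes len: "length es = d" and esc: "set es \<subseteq> carrier_mat d d"
    and orth: "\<And>i j. i < d \<Longrightarrow> j < d \<Longrightarrow>
      adj (es ! i * p) * (es ! j * p) = (if i = j then 1 else 0) \<cdot>\<^sub>m p"
  shows "max_correctable N P (map emb es)"
proof (rule max_correctable_orthonormal)
  show "set (map emb es) \<subseteq> carrier_mat N N" using esc by auto
  fix i j assume ij: "i < d" "j < d"
  have c: "es ! i \<in> carrier_mat d d" "es ! j \<in> carrier_mat d d" using esc len ij by auto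
  have "P * adj (emb (es ! i)) * emb (es ! j) * P = adj (emb (es ! i) * P) * (emb (es ! j) * P)"
    using c by (simp add: KL_product)
  also have "\<dots> = emb (adj (es ! i * p) * (es ! j * p))"
    using c by (simp add: emb_mult_P emb_mult emb_adj)
  also have "\<dots> = (if i = j then 1 else 0) \<cdot>\<^sub>m P" unfolding orth[OF ij] by (simp add: emb_smult emb_p)
  finally show "P * adj (map emb es ! i) * map emb es ! j * P = (if i = j then 1 else 0) \<cdot>\<^sub>m P"
    using ij len by simp
qed (use len in simp)

lemma max_correctable_basis_errors: "max_correctable N P basis_errors"
proof -
  define u :: "nat \<Rightarrow> complex mat" where "u i = mat d 1 (\<lambda>(a, b). if a = i then 1 else 0)" for i
  have u [simp]: "u i \<in> carrier_mat d 1" for i unfolding u_def by simp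
  have "basis_errors = map emb (map (\<lambda>i. u i * adj v) [0..<d])"
    unfolding basis_errors_def u_def by simp
  moreover have "max_correctable N P (map emb (map (\<lambda>i. u i * adj v) [0..<d]))"
  proof (rule max_correctable_emb)
    fix i j assume ij: "i < d" "j < d"
    have up: "u i * adj v * p = u i * adj v" for i
    proof -
      have "u i * adj v * p = u i * (adj v * p)" by (rule assoc_mult_mat[of _ d 1 _ d _ d]) simp_all
      also have "adj v * p = adj (p * v)" by (simp add: adj_mult[of _ d d _ 1] p_adj)
      finally show ?thesis by (simp add: p_mult_v)
    qed
    have uu: "adj (u i) * u j = (if i = j then 1 else 0) \<cdot>\<^sub>m 1\<^sub>m 1"
      using ij by (intro eq_matI)
        (auto simp: u_def mult_index if_distrib[of "\<lambda>x. x * _"] if_distrib[of cnj] cong: if_cong simp del: index_mult_mat(1))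
    have "adj (u i * adj v) * (u j * adj v) = v * adj (u i) * (u j * adj v)"
      by (subst adj_mult[of _ d 1 _ d]) simp_all
    also have "\<dots> = v * (adj (u i) * (u j * adj v))" by (rule assoc_mult_mat[of _ d 1 _ d _ d]) simp_all
    also have "adj (u i) * (u j * adj v) = adj (u i) * u j * adj v"
      by (rule assoc_mult_mat[of _ 1 d _ 1 _ d, symmetric]) simp_all
    also have "\<dots> = (if i = j then 1 else 0) \<cdot>\<^sub>m adj v" unfolding uu
      by (subst mult_smult_assoc_mat[of _ 1 1 _ d]) (simp_all add: left_mult_one_mat[of _ 1 d])
    also have "v * ((if i = j then 1 else 0) \<cdot>\<^sub>m adj v) = (if i = j then 1 else 0) \<cdot>\<^sub>m p"
      unfolding p_v by (rule mult_smult_distrib[of _ d 1 _ d]) simp_all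
    finally show "adj (map (\<lambda>i. u i * adj v) [0..<d] ! i * p) * (map (\<lambda>i. u i * adj v) [0..<d] ! j * p)
       = (if i = j then 1 else 0) \<cdot>\<^sub>m p" using ij by (simp add: up)
  qed auto
  ultimately show ?thesis by simp
qed

lemma factors_basis_errors: "E \<in> set basis_errors \<Longrightarrow> factors E"
  unfolding basis_errors_def by (auto intro!: factors_emb)

lemma mspan_basis_errors: "mspan N ((\<lambda>E. E * P) ` set basis_errors) = frame_errors"
  by (rule mspan_max_correctable[OF max_correctable_basis_errors factors_basis_errors])

lemma factors_of_err_equiv:
  assumes "correctable N P Es" "err_equiv N P basis_errors Es" "E \<in> set Es"
  shows "factors E"
proof -
  have "(\<lambda>E. E * P) ` set Es \<subseteq> carrier_mat N N" using assms(1) unfolding correctable_def by auto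
  then have "E * P \<in> frame_errors"
    using mspan_superset[of _ N "E * P"] assms(2,3) mspan_basis_errors unfolding err_equiv_def by auto
  then show ?thesis unfolding factors_def frame_errors_def by auto
qed

lemma err_equiv_basis_errors:
  assumes "max_correctable N P Es" "\<And>E. E \<in> set Es \<Longrightarrow> factors E"
  shows "err_equiv N P basis_errors Es"
  using mspan_basis_errors mspan_max_correctable[OF assms] unfolding err_equiv_def by simp

text \<open>Duality makes \<open>Uh \<chi> * p\<close> an eigenoperator of each \<open>UR g\<close>
  with eigenvalue \<chi>(g). For different characters, inserting the square of a \<open>UR g\<close>
  at which they disagree negates the product; for equal ones unitarity leaves
  \<open>p\<close>.\<close>

lemma dual_rep_orthogonal:
  assumes dual: "dual_rep (n - k) d UR Uh" and \<chi>: "\<chi> \<in> chars (n - k)" and \<psi>: "\<psi> \<in> chars (n - k)"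
  shows "adj (Uh \<chi> * p) * (Uh \<psi> * p) = (if \<chi> = \<psi> then 1 else 0) \<cdot>\<^sub>m p"
proof -
  have Uh: "unitary_mat d (Uh \<chi>)" "unitary_mat d (Uh \<psi>)" using dual \<chi> \<psi> unfolding dual_rep_def by auto
  note Uc = unitary_matD(1)[OF Uh(1)] unitary_matD(1)[OF Uh(2)]
  show ?thesis
  proof (cases "\<chi> = \<psi>")
    case True
    have "adj (Uh \<psi> * p) * (Uh \<psi> * p) = p * (adj (Uh \<psi>) * Uh \<psi>) * p"
      using Uc by (simp add: adj_mult[of _ d d _ d] p_adj assoc_mult_mat[of _ d d _ d _ d])
    then show ?thesis using True unitary_matD(3)[OF Uh(2)] by (simp add: p_square)
  next
    case False
    then obtain g where g: "g \<in> G" "\<chi> g * \<psi> g = -1" using chars_neqE \<chi> \<psi> by metis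
    have eig: "UR g * (Uh \<xi> * p) = \<xi> g \<cdot>\<^sub>m (Uh \<xi> * p)" if \<xi>: "\<xi> \<in> chars (n - k)" for \<xi>
    proof -
      have c: "Uh \<xi> \<in> carrier_mat d d" using dual \<xi> unfolding dual_rep_def unitary_mat_def by auto
      have comm: "UR g * Uh \<xi> = \<xi> g \<cdot>\<^sub>m (Uh \<xi> * UR g)" using dual \<xi> g unfolding dual_rep_def by auto
      have "UR g * (Uh \<xi> * p) = UR g * Uh \<xi> * p"
        using c g by (simp add: assoc_mult_mat[of _ d d _ d _ d])
      also have "\<dots> = \<xi> g \<cdot>\<^sub>m (Uh \<xi> * (UR g * p))"
        unfolding comm using c g by (simp add: mult_smult_assoc_mat[of _ d d _ d] assoc_mult_mat[of _ d d _ d _ d])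
      finally show ?thesis using g by (simp add: UR_mult_p)
    qed
    define a b where "a = Uh \<chi> * p" and "b = Uh \<psi> * p"
    have ab: "a \<in> carrier_mat d d" "b \<in> carrier_mat d d" unfolding a_def b_def using Uc by auto
    have cnj: "cnj (\<chi> g) = \<chi> g" using charsD(1)[OF \<chi> g(1)] by auto
    have "adj a * b = adj a * (UR g * UR g) * b" using ab g by (simp add: UR_square)
    also have "\<dots> = adj (UR g * a) * (UR g * b)"
      using ab g by (simp add: adj_mult[of _ d d _ d] UR_adj assoc_mult_mat[of _ d d _ d _ d])
    also have "\<dots> = adj (\<chi> g \<cdot>\<^sub>m a) * (\<psi> g \<cdot>\<^sub>m b)"
      unfolding a_def b_def eig[OF \<chi>] eig[OF \<psi>] ..
    also have "\<dots> = (\<chi> g * \<psi> g) \<cdot>\<^sub>m (adj a * b)"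
      using ab by (simp add: adj_smult cnj mult.commute mult_smult_assoc_mat[of _ d d _ d] mult_smult_distrib[of _ d d _ d])
    finally have eq: "adj a * b = (-1) \<cdot>\<^sub>m (adj a * b)" using g(2) by simp
    define X where "X = adj a * b"
    have Xc: "X \<in> carrier_mat d d" unfolding X_def using ab by simp
    have "X = 0 \<cdot>\<^sub>m p"
    proof (rule eq_matI)
      fix i j assume ij: "i < dim_row (0 \<cdot>\<^sub>m p)" "j < dim_col (0 \<cdot>\<^sub>m p)"
      have "X $$ (i, j) = ((-1) \<cdot>\<^sub>m X) $$ (i, j)" using eq unfolding X_def[symmetric] by simp
      then show "X $$ (i, j) = (0 \<cdot>\<^sub>m p) $$ (i, j)" using ij Xc carrier_matD[OF p_carrier] by simp
    qed (use Xc carrier_matD[OF p_carrier] in auto)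
    then show ?thesis using False unfolding X_def a_def b_def by simp
  qed
qed

lemma max_correctable_dual_rep:
  assumes dual: "dual_rep (n - k) d UR Uh" and "distinct \<chi>s" "set \<chi>s = chars (n - k)"
  shows "max_correctable N P (map (\<lambda>\<chi>. emb (Uh \<chi>)) \<chi>s)"
proof -
  have len: "length \<chi>s = d" using assms distinct_card[of \<chi>s] by simp
  have "max_correctable N P (map emb (map Uh \<chi>s))"
  proof (rule max_correctable_emb)
    show "set (map Uh \<chi>s) \<subseteq> carrier_mat d d" using assms unfolding dual_rep_def unitary_mat_def by auto
    fix i j assume ij: "i < d" "j < d"
    then have "\<chi>s ! i \<in> chars (n - k)" "\<chi>s ! j \<in> chars (n - k)" "\<chi>s ! i = \<chi>s ! j \<longleftrightarrow> i = j"
      using assms len by (auto simp: nth_eq_iff_index_eq simp flip: assms(3))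
    then show "adj (map Uh \<chi>s ! i * p) * (map Uh \<chi>s ! j * p) = (if i = j then 1 else 0) \<cdot>\<^sub>m p"
      using dual_rep_orthogonal[OF dual] ij len by simp
  qed (use len in simp)
  then show ?thesis by (simp add: comp_def)
qed

lemma factors_dual_rep:
  assumes "dual_rep (n - k) d UR Uh" "\<chi> \<in> chars (n - k)"
  shows "factors (emb (Uh \<chi>))"
  using assms unfolding dual_rep_def unitary_mat_def by (auto intro!: factors_emb)

end

section \<open>From a maximal Pauli error set to a tensor factorization\<close>

text \<open>Padding with zeros makes both factors square, so a right inverse would be two-sided; but
  if s < d the reversed product has last diagonal entry 0.\<close>

lemma one_factorization_le:
  fixes L R :: "complex mat"
  assumes L: "L \<in> carrier_mat d s" and R: "R \<in> carrier_mat s d" and LR: "L * R = 1\<^sub>m d"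
  shows "d \<le> s"
proof (rule ccontr)
  assume "\<not> d \<le> s"
  then have s: "s < d" by simp
  define L' where "L' = mat d d (\<lambda>(i, j). if j < s then L $$ (i, j) else 0)"
  define R' where "R' = mat d d (\<lambda>(i, j). if i < s then R $$ (i, j) else 0)"
  have c: "L' \<in> carrier_mat d d" "R' \<in> carrier_mat d d" unfolding L'_def R'_def by auto
  have "L' * R' = L * R"
  proof (rule eq_matI)
    fix i j assume "i < dim_row (L * R)" "j < dim_col (L * R)"
    then have ij: "i < d" "j < d" using L R by auto
    have "(L' * R') $$ (i, j) = (\<Sum>l<d. if l \<in> {..<s} then L $$ (i, l) * R $$ (l, j) else 0)"
      using ij c by (auto simp: mult_index L'_def R'_def intro!: sum.cong simp del: index_mult_mat(1))
    also have "\<dots> = (\<Sum>l\<in>{..<d} \<inter> {..<s}. L $$ (i, l) * R $$ (l, j))"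
      by (rule sum.inter_restrict[symmetric]) simp
    also have "{..<d} \<inter> {..<s} = {..<s}" using s by auto
    also have "(\<Sum>l<s. L $$ (i, l) * R $$ (l, j)) = (L * R) $$ (i, j)"
      using ij L R by (auto simp: mult_index simp del: index_mult_mat(1))
    finally show "(L' * R') $$ (i, j) = (L * R) $$ (i, j)" .
  qed (use c L R in auto)
  then have "R' * L' = 1\<^sub>m d" using mat_mult_left_right_inverse[OF c] LR by simp
  then have "(R' * L') $$ (d - 1, d - 1) = 1" using s by simp
  moreover have "(R' * L') $$ (d - 1, d - 1) = 0"
  proof -
    have "(R' * L') $$ (d - 1, d - 1) = (\<Sum>l<d. R' $$ (d - 1, l) * L' $$ (l, d - 1))"
      using s c by (auto simp: mult_index simp del: index_mult_mat(1))
    also have "\<dots> = 0" using s by (intro sum.neutral) (auto simp: R'_def)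
    finally show ?thesis .
  qed
  ultimately show False by simp
qed

section \<open>Syndromes of Pauli errors\<close>

context stabilizer_code
begin

definition has_syndrome :: "complex mat \<Rightarrow> (bool list \<Rightarrow> complex) \<Rightarrow> bool" where
  "has_syndrome E \<chi> \<longleftrightarrow> \<chi> \<in> chars (n - k) \<and> (\<forall>g\<in>G. U g * E = \<chi> g \<cdot>\<^sub>m (E * U g))"

lemma pauli_has_syndrome:
  assumes E: "E \<in> pauli_group n"
  shows "\<exists>\<chi>. has_syndrome E \<chi>"
proof -
  have Eu: "unitary_mat N E" and Ec [simp]: "E \<in> carrier_mat N N"
    using pauli_group_unitary[OF E] unitary_matD by auto
  obtain s where s: "\<And>g. g \<in> G \<Longrightarrow> s g \<in> {1, -1} \<and> U g * E = s g \<cdot>\<^sub>m (E * U g)"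
    using pauli_group_commute[OF U_pauli E] by metis
  \<comment> \<open>Moving \<open>U g * U h\<close> past \<open>E\<close> in one step or in two
    gives two scalars in front of the same unitary, which cancels.\<close>
  have mult: "s (gmul g h) = s g * s h" if g: "g \<in> G" and h: "h \<in> G" for g h
  proof -
    have "s (gmul g h) \<cdot>\<^sub>m (E * U (gmul g h)) = U g * U h * E"
      using s[of "gmul g h"] g h by (simp add: U_gmul)
    also have "\<dots> = U g * (U h * E)" using g h by (simp add: assoc_mult_mat[of _ N N _ N _ N])
    also have "\<dots> = s h \<cdot>\<^sub>m (U g * (E * U h))"
      using s[OF h] g h by (simp add: mult_smult_distrib[of _ N N _ N])
    also have "U g * (E * U h) = (U g * E) * U h" using g h by (simp add: assoc_mult_mat[of _ N N _ N _ N])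
    also have "\<dots> = s g \<cdot>\<^sub>m (E * U g * U h)"
      using s[OF g] g h by (simp add: mult_smult_assoc_mat[of _ N N _ N])
    also have "E * U g * U h = E * U (gmul g h)"
      using g h by (simp add: U_gmul assoc_mult_mat[of _ N N _ N _ N])
    finally have "s (gmul g h) \<cdot>\<^sub>m (E * U (gmul g h)) = (s g * s h) \<cdot>\<^sub>m (E * U (gmul g h))"
      by (simp add: mult.commute)
    moreover have "unitary_mat N (E * U (gmul g h))"
      using Eu U_unitary[OF gmul_in[OF g h]] by (rule unitary_mult)
    ultimately show ?thesis using unitary_smult_cancel[of N "E * U (gmul g h)"] by simp
  qed
  have "has_syndrome E (\<lambda>g. if g \<in> G then s g else 1)"
    unfolding has_syndrome_def chars_def using s mult by auto
  then show ?thesis by blast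
qed

text \<open>The adjoint of \<open>E\<close> carries the same sign as \<open>E\<close>, because signs
  are real.\<close>

lemma syndrome_product:
  assumes E: "has_syndrome E \<chi>" "E \<in> carrier_mat N N" and F: "has_syndrome F \<psi>" "F \<in> carrier_mat N N"
    and g: "g \<in> G"
  shows "U g * (adj E * F) = (\<chi> g * \<psi> g) \<cdot>\<^sub>m (adj E * F * U g)"
proof -
  have \<chi>: "\<chi> g = 1 \<or> \<chi> g = -1" using E charsD(1) g unfolding has_syndrome_def by blast
  have "adj (U g * E) = adj (\<chi> g \<cdot>\<^sub>m (E * U g))" using E g unfolding has_syndrome_def by auto
  then have "adj E * U g = cnj (\<chi> g) \<cdot>\<^sub>m (U g * adj E)"
    using E(2) g by (simp add: adj_mult[of _ N N _ N] adj_smult U_adj)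
  then have "\<chi> g \<cdot>\<^sub>m (adj E * U g) = U g * adj E" using \<chi> by auto
  then have "U g * (adj E * F) = \<chi> g \<cdot>\<^sub>m (adj E * U g) * F"
    using E(2) F(2) g by (simp add: assoc_mult_mat[of _ N N _ N _ N])
  also have "\<dots> = \<chi> g \<cdot>\<^sub>m (adj E * (U g * F))"
    using E(2) F(2) g by (simp add: mult_smult_assoc_mat[of _ N N _ N] assoc_mult_mat[of _ N N _ N _ N])
  also have "U g * F = \<psi> g \<cdot>\<^sub>m (F * U g)" using F g unfolding has_syndrome_def by auto
  finally show ?thesis using E(2) F(2) g
    by (simp add: mult_smult_distrib[of _ N N _ N] assoc_mult_mat[of _ N N _ N _ N])
qed

text \<open>The code projectors on both sides absorb \<open>U g\<close>, so moving
  \<open>U g\<close> across \<open>adj E * F\<close> reproduces the operator with sign -1.\<close>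

lemma different_syndromes:
  assumes E: "has_syndrome E \<chi>" "E \<in> carrier_mat N N" and F: "has_syndrome F \<psi>" "F \<in> carrier_mat N N"
    and neq: "\<chi> \<noteq> \<psi>"
  shows "adj (E * P) * (F * P) = 0\<^sub>m N N"
proof -
  obtain g where g: "g \<in> G" "\<chi> g * \<psi> g = -1" using chars_neqE E F neq unfolding has_syndrome_def by metis
  define X where "X = adj E * F"
  have Xc: "X \<in> carrier_mat N N" unfolding X_def using E F by simp
  have PXP: "adj (E * P) * (F * P) = P * (X * P)"
    unfolding X_def using E F by (simp add: adj_mult[of _ N N _ N] P_adj assoc_mult_mat[of _ N N _ N _ N])
  define Y where "Y = P * (X * P)"
  have Yc: "Y \<in> carrier_mat N N" unfolding Y_def using Xc by simp
  have "Y = P * U g * (X * P)" unfolding Y_def using g by (simp add: P_mult_U)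
  also have "\<dots> = P * ((U g * X) * P)" using Xc g by (simp add: assoc_mult_mat[of _ N N _ N _ N])
  also have "U g * X = (-1) \<cdot>\<^sub>m (X * U g)" using syndrome_product[OF E F g(1)] g(2) unfolding X_def by simp
  also have "P * ((-1) \<cdot>\<^sub>m (X * U g) * P) = (-1) \<cdot>\<^sub>m (P * (X * (U g * P)))"
    using Xc g by (simp add: mult_smult_assoc_mat[of _ N N _ N] mult_smult_distrib[of _ N N _ N] assoc_mult_mat[of _ N N _ N _ N])
  finally have eq: "Y = (-1) \<cdot>\<^sub>m Y" unfolding Y_def using g by (simp add: U_mult_P)
  have "Y = 0\<^sub>m N N"
  proof (rule eq_matI)
    fix i j assume ij: "i < dim_row (0\<^sub>m N N)" "j < dim_col (0\<^sub>m N N)"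
    have "Y $$ (i, j) = ((-1) \<cdot>\<^sub>m Y) $$ (i, j)" using eq by simp
    then show "Y $$ (i, j) = 0\<^sub>m N N $$ (i, j)" using ij Yc by simp
  qed (use Yc in auto)
  then show ?thesis using PXP Y_def by simp
qed

text \<open>The operator \<open>adj E * F\<close> commutes with every stabilizer, hence with the
  code projector. One projector in the Knill-Laflamme product is thereby absorbed, and multiplying
  by the unitary \<open>E\<close> isolates \<open>F * P\<close>.\<close>

lemma same_syndrome:
  assumes E: "has_syndrome E \<chi>" "unitary_mat N E" and F: "has_syndrome F \<chi>" "F \<in> carrier_mat N N"
    and c: "adj (E * P) * (F * P) = c \<cdot>\<^sub>m P"
  shows "F * P = c \<cdot>\<^sub>m (E * P)"
proof -
  note Ec = unitary_matD(1)[OF E(2)]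
  define X where "X = adj E * F"
  have Xc: "X \<in> carrier_mat N N" unfolding X_def using Ec F by simp
  have comm: "U g * X = X * U g" if "g \<in> G" for g
    using syndrome_product[OF E(1) Ec F that] E(1) char_square that
    unfolding X_def has_syndrome_def by (metis one_smult_mat)
  have PX: "P * X = X * P" unfolding P_avg using Xc comm
    by (simp add: avg_mat_mult mult_avg_mat cong: avg_mat_cong)
  have "adj (E * P) * (F * P) = (P * X) * P"
    unfolding X_def using Ec F by (simp add: adj_mult[of _ N N _ N] P_adj assoc_mult_mat[of _ N N _ N _ N])
  also have "\<dots> = adj E * (F * P)"
    unfolding PX using Ec F(2) Xc by (simp add: X_def P_square assoc_mult_mat[of _ N N _ N _ N])
  finally have "adj E * (F * P) = c \<cdot>\<^sub>m P" using c by simp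
  then have "E * (adj E * (F * P)) = c \<cdot>\<^sub>m (E * P)"
    using Ec by (simp add: mult_smult_distrib[of _ N N _ N])
  moreover have "E * (adj E * (F * P)) = (E * adj E) * (F * P)"
    using Ec F(2) by (simp add: assoc_mult_mat[of _ N N _ N _ N])
  ultimately show ?thesis using unitary_matD(2)[OF E(2)] F(2) by simp
qed

lemma pauli_norm:
  assumes "unitary_mat N E" shows "adj (E * P) * (E * P) = P"
proof -
  note E = unitary_matD[OF assms]
  have "adj (E * P) * (E * P) = P * (adj E * E) * P"
    using E(1) by (simp add: adj_mult[of _ N N _ N] P_adj assoc_mult_mat[of _ N N _ N _ N])
  then show ?thesis using E by (simp add: P_square)
qed

text \<open>Errors with equal syndrome act proportionally on the code, so the Knill-Laflamme matrix
  factors through the set of syndromes; maximal rank therefore forces every character to occur.\<close>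

lemma all_syndromes_occur:
  assumes Es: "set Es \<subseteq> pauli_group n" and max: "max_correctable N P Es"
    and synd: "\<And>i. i < length Es \<Longrightarrow> has_syndrome (Es ! i) (\<chi> i)"
  shows "\<chi> ` {..<length Es} = chars (n - k)"
proof -
  define m where "m = length Es"
  define S where "S = \<chi> ` {..<m}"
  have Eu: "unitary_mat N (Es ! i)" if "i < m" for i
    using Es that pauli_group_unitary m_def by (meson nth_mem subsetD)
  note Ec = unitary_matD(1)[OF Eu]
  have synd: "has_syndrome (Es ! i) (\<chi> i)" if "i < m" for i using synd that m_def by simp
  obtain C where KL: "KL_matrix N P Es C" and rk: "mrank m C = d"
    using max unfolding max_correctable_def syndrome_count m_def by auto
  have C: "C \<in> carrier_mat m m" using KL unfolding KL_matrix_def m_def by auto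
  have KL: "adj (Es ! i * P) * (Es ! j * P) = C $$ (i, j) \<cdot>\<^sub>m P" if "i < m" "j < m" for i j
    using KL KL_product Ec that unfolding KL_matrix_def m_def by auto
  \<comment> \<open>If \<open>l\<close> and \<open>j\<close> share a syndrome, column j of
    \<open>C\<close> is a multiple of column l.\<close>
  have C1: "C $$ (i, j) = C $$ (i, l) * C $$ (l, j)" if "i < m" "j < m" "l < m" "\<chi> l = \<chi> j" for i j l
  proof -
    have "Es ! j * P = C $$ (l, j) \<cdot>\<^sub>m (Es ! l * P)"
      using same_syndrome[OF synd Eu _ Ec KL] synd that by metis
    then have "adj (Es ! i * P) * (Es ! j * P) = C $$ (l, j) \<cdot>\<^sub>m (adj (Es ! i * P) * (Es ! l * P))"
      using Ec that by (simp add: mult_smult_distrib[of _ N N _ N])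
    then have "C $$ (i, j) \<cdot>\<^sub>m P = (C $$ (l, j) * C $$ (i, l)) \<cdot>\<^sub>m P" using KL that by simp
    then show ?thesis using P_smult_cancel by (simp add: mult.commute)
  qed
  have "S \<subseteq> chars (n - k)" using synd unfolding S_def has_syndrome_def by auto
  moreover have "d \<le> card S"
  proof -
    have "finite S" unfolding S_def by simp
    then obtain \<beta> where \<beta>: "bij_betw \<beta> {..<card S} S"
      using ex_bij_betw_nat_finite[of S] by (auto simp: lessThan_atLeast0)
    have "\<exists>i<m. \<chi> i = \<beta> a" if "a < card S" for a
    proof -
      have "\<beta> a \<in> S" using bij_betwE[OF \<beta>] that by auto
      then show ?thesis unfolding S_def by auto
    qed
    then obtain r where r: "\<And>a. a < card S \<Longrightarrow> r a < m \<and> \<chi> (r a) = \<beta> a" by metis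
    \<comment> \<open>\<open>B\<close> keeps one column per syndrome, and \<open>A\<close> writes
      each column of \<open>C\<close> as a multiple of the column of its representative.\<close>
    define B where "B = mat m (card S) (\<lambda>(i, a). C $$ (i, r a))"
    define A where "A = mat (card S) m (\<lambda>(a, j). if \<chi> j = \<beta> a then C $$ (r a, j) else 0)"
    have c: "B \<in> carrier_mat m (card S)" "A \<in> carrier_mat (card S) m" unfolding A_def B_def by auto
    have CBA: "C = B * A"
    proof (rule eq_matI)
      fix i j assume "i < dim_row (B * A)" "j < dim_col (B * A)"
      then have ij: "i < m" "j < m" using c by auto
      have "\<chi> j \<in> \<beta> ` {..<card S}" using ij bij_betw_imp_surj_on[OF \<beta>] unfolding S_def by auto
      then obtain a where a: "a < card S" "\<beta> a = \<chi> j" by auto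
      have uniq: "\<chi> j = \<beta> b \<longleftrightarrow> b = a" if "b < card S" for b
        using a that bij_betw_imp_inj_on[OF \<beta>] by (auto dest: inj_onD)
      have "(B * A) $$ (i, j) = (\<Sum>b<card S. if b = a then C $$ (i, r a) * C $$ (r a, j) else 0)"
        using ij c uniq a(1) by (simp add: mult_index A_def B_def if_distrib[of "\<lambda>x. _ * x"]
            cong: if_cong del: index_mult_mat(1))
      also have "\<dots> = C $$ (i, r a) * C $$ (r a, j)" using a by simp
      also have "\<dots> = C $$ (i, j)" using C1[of i j "r a"] r[OF a(1)] a ij by simp
      finally show "C $$ (i, j) = (B * A) $$ (i, j)" by simp
    qed (use C c in auto)
    obtain V Y where V: "V \<in> carrier_mat m d" "Y \<in> carrier_mat m d" "adj V * V = 1\<^sub>m d" "V = C * Y"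
      using orthonormal_column_basis[OF C rk[symmetric]] by metis
    have AY: "A * Y \<in> carrier_mat (card S) d" using c(2) V(2) by (rule mult_carrier_mat)
    have VB: "adj V * B \<in> carrier_mat d (card S)" using adj_carrier[OF V(1)] c(1) by (rule mult_carrier_mat)
    have "V = B * (A * Y)" using assoc_mult_mat[OF c V(2)] CBA V(4) by simp
    \<comment> \<open>The identity of size d is thus factored through one dimension per occurring
      syndrome.\<close>
    then have "(adj V * B) * (A * Y) = 1\<^sub>m d"
      using assoc_mult_mat[OF adj_carrier[OF V(1)] c(1) AY] V(3) by simp
    then show ?thesis using one_factorization_le[OF VB AY] by simp
  qed
  ultimately show ?thesis
    using card_seteq[of "chars (n - k)" S] unfolding S_def m_def by simp
qed

end

text \<open>\<open>F a = E\<^sub>a \<Pi>\<close> for representatives \<open>E\<^sub>a\<close> of the \<open>d\<close> syndromes \<open>\<beta> a\<close>; the operators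
  \<open>F a (F b)\<^sup>\<dagger>\<close> are a system of matrix units.\<close>

locale syndrome_frame = stabilizer_code n k U for n k U +
  fixes \<beta> :: "nat \<Rightarrow> bool list \<Rightarrow> complex" and F :: "nat \<Rightarrow> complex mat" and V :: "complex mat"
  assumes \<beta>: "bij_betw \<beta> {..<2 ^ (n - k)} (chars (n - k))"
    and F_carrier [simp]: "\<And>a. a < 2 ^ (n - k) \<Longrightarrow> F a \<in> carrier_mat (2 ^ n) (2 ^ n)"
    and F_orth: "\<And>a b. a < 2 ^ (n - k) \<Longrightarrow> b < 2 ^ (n - k) \<Longrightarrow>
      adj (F a) * F b = (if a = b then proj_pn n k U else 0\<^sub>m (2 ^ n) (2 ^ n))"
    and F_eig: "\<And>a g. a < 2 ^ (n - k) \<Longrightarrow> g \<in> Zgrp (n - k) \<Longrightarrow> U g * F a = \<beta> a g \<cdot>\<^sub>m F a"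
    and F_P: "\<And>a. a < 2 ^ (n - k) \<Longrightarrow> F a * proj_pn n k U = F a"
    and V_carrier [simp]: "V \<in> carrier_mat (2 ^ n) (2 ^ k)" and V_isometry: "adj V * V = 1\<^sub>m (2 ^ k)"
    and P_V: "proj_pn n k U * V = V"
begin

text \<open>Column a * K + t is the image under the a-th error of the t-th code basis vector, so the
  first tensor factor records the syndrome and the second the encoded state.\<close>

definition W :: "complex mat" where
  "W = mat N N (\<lambda>(i, c). (F (c div K) * V) $$ (i, c mod K))"

lemma W_carrier [simp]: "W \<in> carrier_mat N N" unfolding W_def by simp

lemma W_index: "i < N \<Longrightarrow> c < N \<Longrightarrow> W $$ (i, c) = (F (c div K) * V) $$ (i, c mod K)"
  unfolding W_def by simp

lemma index_bounds: "c < N \<Longrightarrow> c div K < d" "c < N \<Longrightarrow> c mod K < K"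
  unfolding N_eq by auto

lemma FV_carrier [simp]: "a < d \<Longrightarrow> F a * V \<in> carrier_mat N K"
  by (rule mult_carrier_mat[of _ N N]) simp_all

lemma mult_W_index:
  assumes X: "X \<in> carrier_mat N N" and i: "i < N" and c: "c < N"
  shows "(X * W) $$ (i, c) = (X * (F (c div K) * V)) $$ (i, c mod K)"
proof -
  define Y where "Y = F (c div K) * V"
  have Y: "Y \<in> carrier_mat N K" unfolding Y_def using index_bounds[OF c] by simp
  have WY: "W $$ (l, c) = Y $$ (l, c mod K)" if "l < N" for l using that c W_index Y_def by simp
  have "(X * W) $$ (i, c) = (\<Sum>l<N. X $$ (i, l) * W $$ (l, c))"
    using X i c carrier_matD[OF W_carrier] by (simp add: mult_index del: index_mult_mat(1))
  also have "\<dots> = (X * Y) $$ (i, c mod K)"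
    using X Y i WY index_bounds[OF c] by (simp add: mult_index del: index_mult_mat(1))
  finally show ?thesis unfolding Y_def .
qed

text \<open>Blocks of different syndromes are orthogonal by \<open>F_orth\<close>; inside a block
  the error drops out and \<open>V_isometry\<close> remains.\<close>

lemma W_isometry: "adj W * W = 1\<^sub>m N"
proof (rule eq_matI)
  fix i j assume "i < dim_row (1\<^sub>m N)" "j < dim_col (1\<^sub>m N)"
  then have ij: "i < N" "j < N" by auto
  define A where "A = F (i div K) * V"
  define B where "B = F (j div K) * V"
  have c: "A \<in> carrier_mat N K" "B \<in> carrier_mat N K" unfolding A_def B_def using index_bounds ij by auto
  have b: "i mod K < K" "j mod K < K" "i div K < d" "j div K < d" using index_bounds ij by auto
  have Wi: "W $$ (l, i) = A $$ (l, i mod K)" "W $$ (l, j) = B $$ (l, j mod K)" if "l < N" for l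
    using that ij W_index A_def B_def by auto
  have "(adj W * W) $$ (i, j) = (\<Sum>l<N. cnj (W $$ (l, i)) * W $$ (l, j))"
    using ij carrier_matD[OF W_carrier] by (simp add: mult_index del: index_mult_mat(1))
  also have "\<dots> = (adj A * B) $$ (i mod K, j mod K)"
    using c b Wi by (simp add: mult_index del: index_mult_mat(1))
  also have "adj A * B = adj V * (adj (F (i div K)) * (F (j div K) * V))"
    unfolding A_def B_def using b by (subst adj_mult[of _ N N _ K]) (auto intro!: assoc_mult_mat[of _ K N _ N _ K])
  also have "adj (F (i div K)) * (F (j div K) * V) = (adj (F (i div K)) * F (j div K)) * V"
    using b by (intro assoc_mult_mat[of _ N N _ N _ K, symmetric]) auto
  also have "\<dots> = (if i div K = j div K then V else 0\<^sub>m N K)"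
    using F_orth b left_mult_zero_mat[OF V_carrier, of N] by (simp add: P_V)
  also have "adj V * \<dots> = (if i div K = j div K then 1\<^sub>m K else 0\<^sub>m K K)"
    using right_mult_zero_mat[of "adj V" K N K] by (simp add: V_isometry)
  finally have "(adj W * W) $$ (i, j) = (if i div K = j div K \<and> i mod K = j mod K then 1 else 0)"
    using b by auto
  moreover have "i div K = j div K \<and> i mod K = j mod K \<longleftrightarrow> i = j" by (metis div_mult_mod_eq)
  ultimately show "(adj W * W) $$ (i, j) = 1\<^sub>m N $$ (i, j)" using ij by simp
qed (use carrier_matD[OF W_carrier] in auto)

lemma W_unitary: "unitary_mat N W"
  unfolding unitary_mat_def
  using W_isometry mat_mult_left_right_inverse[OF adj_carrier[OF W_carrier] W_carrier W_isometry] by simp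

sublocale tensor_factorization N d K W
  using W_unitary N_eq by unfold_locales auto

text \<open>\<open>adj (F b)\<close> returns block b to the code and kills the other blocks, and
  \<open>F a\<close> then moves the code to block a.\<close>

lemma emb_mat_unit:
  assumes ab: "a < d" "b < d"
  shows "emb (mat_unit d a b) = F a * adj (F b)"
proof -
  have "W * kron (mat_unit d a b) (1\<^sub>m K) = F a * adj (F b) * W"
  proof (rule eq_matI)
    fix i c assume "i < dim_row (F a * adj (F b) * W)" "c < dim_col (F a * adj (F b) * W)"
    then have ic: "i < N" "c < N" using ab carrier_matD[OF F_carrier[of a]] carrier_matD[OF W_carrier] by auto
    note bd = index_bounds[OF ic(2)]
    have lt: "a * K + c mod K < N" using pair_index_less[OF ab(1) bd(2)] N_eq by simp
    have "(W * kron (mat_unit d a b) (1\<^sub>m K)) $$ (i, c)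
        = (\<Sum>l<d. if l = a then (if c div K = b then W $$ (i, a * K + c mod K) else 0) else 0)"
      using ic bd ab by (subst mult_kron_one_index[of _ N])
        (simp_all add: if_distrib[of "\<lambda>x. _ * x"] cong: if_cong)
    also have "\<dots> = (if c div K = b then (F a * V) $$ (i, c mod K) else 0)"
      using ab ic lt bd by (simp add: W_index)
    also have "\<dots> = (F a * adj (F b) * (F (c div K) * V)) $$ (i, c mod K)"
    proof -
      have "F a * adj (F b) * (F (c div K) * V) = F a * (adj (F b) * (F (c div K) * V))"
        using ab bd by (intro assoc_mult_mat[of _ N N _ N _ K]) auto
      also have "adj (F b) * (F (c div K) * V) = (adj (F b) * F (c div K)) * V"
        using ab bd by (intro assoc_mult_mat[of _ N N _ N _ K, symmetric]) auto
      also have "\<dots> = (if c div K = b then V else 0\<^sub>m N K)" using F_orth ab bd left_mult_zero_mat[OF V_carrier, of N] by (auto simp: P_V)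
      also have "F a * \<dots> = (if c div K = b then F a * V else 0\<^sub>m N K)"
        using right_mult_zero_mat[of "F a" N N K] ab by simp
      finally show ?thesis using ic bd by simp
    qed
    also have "\<dots> = (F a * adj (F b) * W) $$ (i, c)"
      using mult_W_index[OF _ ic, of "F a * adj (F b)"] ab by simp
    finally show "(W * kron (mat_unit d a b) (1\<^sub>m K)) $$ (i, c) = (F a * adj (F b) * W) $$ (i, c)" .
  qed (use ab carrier_matD[OF F_carrier[of a]] carrier_matD[OF W_carrier] in \<open>auto simp: N_eq\<close>)
  then show ?thesis unfolding emb_def using conj_iff[of "kron (mat_unit d a b) (1\<^sub>m K)" "F a * adj (F b)"] ab by simp
qed

section \<open>The frame representation and its orientation states\<close>

definition UR :: "bool list \<Rightarrow> complex mat" where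
  "UR g = mat d d (\<lambda>(a, b). if a = b then \<beta> a g else 0)"

lemma UR_carrier [simp]: "UR g \<in> carrier_mat d d" unfolding UR_def by simp

lemma emb_UR:
  assumes g: "g \<in> G" shows "emb (UR g) = U g"
proof -
  have "W * kron (UR g) (1\<^sub>m K) = U g * W"
  proof (rule eq_matI)
    fix i c assume "i < dim_row (U g * W)" "c < dim_col (U g * W)"
    then have ic: "i < N" "c < N" using g carrier_matD[OF U_carrier[OF g]] carrier_matD[OF W_carrier] by auto
    note bd = index_bounds[OF ic(2)]
    have "(W * kron (UR g) (1\<^sub>m K)) $$ (i, c)
        = (\<Sum>l<d. if l = c div K then W $$ (i, c) * \<beta> (c div K) g else 0)"
      using ic bd div_mult_mod_eq[of c K] by (subst mult_kron_one_index[of _ N])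
        (simp_all add: UR_def if_distrib[of "\<lambda>x. _ * x"] cong: if_cong)
    also have "\<dots> = \<beta> (c div K) g * (F (c div K) * V) $$ (i, c mod K)"
      using ic bd by (simp add: W_index)
    also have "\<dots> = (\<beta> (c div K) g \<cdot>\<^sub>m (F (c div K) * V)) $$ (i, c mod K)"
      using ic bd carrier_matD[OF F_carrier[OF bd(1)]] carrier_matD[OF V_carrier] by simp
    also have "\<beta> (c div K) g \<cdot>\<^sub>m (F (c div K) * V) = U g * F (c div K) * V"
      unfolding F_eig[OF bd(1) g] using bd by (intro mult_smult_assoc_mat[of _ N N _ K, symmetric]) auto
    also have "\<dots> = U g * (F (c div K) * V)"
      using g bd by (intro assoc_mult_mat[of _ N N _ N _ K]) auto
    also have "(U g * (F (c div K) * V)) $$ (i, c mod K) = (U g * W) $$ (i, c)"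
      using mult_W_index[OF U_carrier[OF g] ic] by simp
    finally show "(W * kron (UR g) (1\<^sub>m K)) $$ (i, c) = (U g * W) $$ (i, c)" .
  qed (use g carrier_matD[OF U_carrier[OF g]] carrier_matD[OF W_carrier] carrier_matD[OF UR_carrier[of g]] in \<open>auto simp: N_eq\<close>)
  then show ?thesis unfolding emb_def using conj_iff[of "kron (UR g) (1\<^sub>m K)" "U g"] g by simp
qed

definition ket :: "bool list \<Rightarrow> complex vec" where
  "ket g = vec d (\<lambda>a. \<beta> a g / complex_of_real (sqrt (real d)))"

lemma sqrt_d: "complex_of_real (sqrt (real d)) * complex_of_real (sqrt (real d)) = of_nat d"
  by (simp flip: of_real_mult del: of_nat_power)

lemma \<beta>_char: "a < d \<Longrightarrow> \<beta> a \<in> chars (n - k)"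
  using bij_betwE[OF \<beta>] by auto

lemma ket_orthonormal:
  assumes "g \<in> G" "h \<in> G"
  shows "cinner (ket g) (ket h) = (if g = h then 1 else 0)"
proof -
  have "cinner (ket g) (ket h) = (\<Sum>a<d. \<beta> a g * \<beta> a h / of_nat d)"
    unfolding cinner_def ket_def
  proof (simp, intro sum.cong refl)
    fix a assume "a \<in> {..<d}"
    then have "cnj (\<beta> a g) = \<beta> a g" using charsD(1)[OF \<beta>_char assms(1), of a] by auto
    then show "cnj (\<beta> a g) * \<beta> a h / (complex_of_real (sqrt (2 ^ (n - k))) * complex_of_real (sqrt (2 ^ (n - k)))) = \<beta> a g * \<beta> a h / 2 ^ (n - k)"
      using sqrt_d by simp
  qed
  also have "\<dots> = (\<Sum>\<chi>\<in>chars (n - k). \<chi> g * \<chi> h / of_nat d)"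
    by (rule sum.reindex_bij_betw[OF \<beta>])
  also have "\<dots> = (if g = h then 1 else 0)"
    using sum_chars[OF assms] by (simp flip: sum_divide_distrib)
  finally show ?thesis .
qed

lemma ket_complete:
  assumes x: "x \<in> carrier_vec d"
  shows "\<exists>\<alpha>. x = vec d (\<lambda>i. \<Sum>g\<in>G. \<alpha> g * ket g $ i)"
proof
  let ?s = "complex_of_real (sqrt (real d))"
  \<comment> \<open>The coefficients are the inner products of \<open>ket g\<close> with
    \<open>x\<close>; no conjugate is written because \<open>ket g\<close> has real entries.\<close>
  show "x = vec d (\<lambda>i. \<Sum>g\<in>G. (\<Sum>j<d. \<beta> j g / ?s * x $ j) * ket g $ i)"
  proof (rule eq_vecI)
    fix i assume "i < dim_vec (vec d (\<lambda>i. \<Sum>g\<in>G. (\<Sum>j<d. \<beta> j g / ?s * x $ j) * ket g $ i))"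
    then have i: "i < d" by simp
    have "(\<Sum>g\<in>G. (\<Sum>j<d. \<beta> j g / ?s * x $ j) * ket g $ i)
        = (\<Sum>g\<in>G. \<Sum>j<d. \<beta> j g * \<beta> i g * x $ j / of_nat d)"
      unfolding sqrt_d[symmetric] ket_def sum_distrib_right using i by (intro sum.cong) (auto simp: mult_ac)
    also have "\<dots> = (\<Sum>j<d. (\<Sum>g\<in>G. \<beta> j g * \<beta> i g) * x $ j / of_nat d)"
      by (subst sum.swap) (simp add: sum_distrib_right sum_divide_distrib)
    also have "\<dots> = (\<Sum>j<d. if j = i then x $ i else 0)"
    proof (intro sum.cong refl)
      fix j assume "j \<in> {..<d}"
      then have j: "j < d" by simp
      have "\<beta> j = \<beta> i \<longleftrightarrow> j = i" using bij_betw_imp_inj_on[OF \<beta>] i j by (auto dest: inj_onD)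
      then show "(\<Sum>g\<in>G. \<beta> j g * \<beta> i g) * x $ j / of_nat d = (if j = i then x $ i else 0)"
        using sum_char_Zgrp[OF \<beta>_char[OF j] \<beta>_char[OF i]] by simp
    qed
    also have "\<dots> = x $ i" using i by simp
    finally show "x $ i = vec d (\<lambda>i. \<Sum>g\<in>G. (\<Sum>j<d. \<beta> j g / ?s * x $ j) * ket g $ i) $ i" using i by simp
  qed (use x in auto)
qed

text \<open>Component a is multiplied by \<beta> a g, and characters are multiplicative. All phases
  are 1 for these states.\<close>

lemma UR_ket:
  assumes "g \<in> G" "h \<in> G"
  shows "UR g *\<^sub>v ket h = ket (gmul g h)"
proof (rule eq_vecI)
  fix a assume "a < dim_vec (ket (gmul g h))"
  then have a: "a < d" unfolding ket_def by simp
  have "(UR g *\<^sub>v ket h) $ a = (\<Sum>b<d. UR g $$ (a, b) * ket h $ b)"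
    using a unfolding UR_def
    by (simp add: mult_mat_vec_def scalar_prod_def lessThan_atLeast0 ket_def)
  also have "\<dots> = (\<Sum>b<d. if b = a then \<beta> a g * ket h $ a else 0)"
    using a by (intro sum.cong) (auto simp: UR_def)
  finally show "(UR g *\<^sub>v ket h) $ a = ket (gmul g h) $ a"
    using a charsD(2)[OF \<beta>_char[OF a] assms] by (simp add: ket_def)
qed (simp add: ket_def UR_def)

text \<open>A generator \<open>F a\<close> alone maps the code to a block and need not respect the
  tensor product. Since the code projector is itself a multiple of some \<open>F a0\<close>, each
  \<open>F a\<close> is a multiple of \<open>F a * adj (F a0)\<close>, a matrix unit; conversely all
  matrix units are products of generators and their adjoints.\<close>

lemma star_alg_eq:
  assumes S: "\<And>a. a < d \<Longrightarrow> F a \<in> S"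
    and gen: "\<And>X. X \<in> S \<Longrightarrow> \<exists>c. \<exists>a<d. X = c \<cdot>\<^sub>m F a"
    and P: "P \<in> S"
  shows "star_alg N S = {emb a |a. a \<in> carrier_mat d d}"
proof (intro equalityI subsetI)
  obtain c0 a0 where P0: "a0 < d" "P = c0 \<cdot>\<^sub>m F a0" using gen[OF P] by auto
  have F_emb: "F a = emb (cnj c0 \<cdot>\<^sub>m mat_unit d a a0)" if a: "a < d" for a
  proof -
    have "F a = F a * adj P" using F_P[OF a] P_adj by simp
    also have "\<dots> = cnj c0 \<cdot>\<^sub>m (F a * adj (F a0))"
      unfolding P0(2) adj_smult using a P0(1) by (intro mult_smult_distrib[of _ N N _ N]) auto
    finally show ?thesis using emb_mat_unit[OF a P0(1)] emb_smult[OF mat_unit_carrier(1)] by simp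
  qed
  fix A assume "A \<in> star_alg N S"
  then show "A \<in> {emb a |a. a \<in> carrier_mat d d}"
  proof (rule star_alg_closed)
    show "S \<subseteq> {emb a |a. a \<in> carrier_mat d d}"
    proof
      fix X assume "X \<in> S"
      then obtain c a where X: "a < d" "X = c \<cdot>\<^sub>m F a" using gen by blast
      have "X = emb (c \<cdot>\<^sub>m (cnj c0 \<cdot>\<^sub>m mat_unit d a a0))"
        unfolding X(2) using F_emb[OF X(1)] emb_smult[of "cnj c0 \<cdot>\<^sub>m mat_unit d a a0" c] by simp
      then show "X \<in> {emb a |a. a \<in> carrier_mat d d}" by auto
    qed
    show "1\<^sub>m N \<in> {emb a |a. a \<in> carrier_mat d d}" using emb_one[symmetric] by auto
  next
    fix A B assume "A \<in> {emb a |a. a \<in> carrier_mat d d}" "B \<in> {emb a |a. a \<in> carrier_mat d d}"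
    then obtain a b where "a \<in> carrier_mat d d" "b \<in> carrier_mat d d" "A = emb a" "B = emb b" by auto
    then have "A + B = emb (a + b)" "A * B = emb (a * b)" "a + b \<in> carrier_mat d d" "a * b \<in> carrier_mat d d"
      by (simp_all add: emb_add emb_mult)
    then show "A + B \<in> {emb a |a. a \<in> carrier_mat d d}" "A * B \<in> {emb a |a. a \<in> carrier_mat d d}" by auto
  next
    fix c A assume "A \<in> {emb a |a. a \<in> carrier_mat d d}"
    then obtain a where "a \<in> carrier_mat d d" "A = emb a" by auto
    then have "c \<cdot>\<^sub>m A = emb (c \<cdot>\<^sub>m a)" "adj A = emb (adj a)" "c \<cdot>\<^sub>m a \<in> carrier_mat d d" "adj a \<in> carrier_mat d d"
      by (simp_all add: emb_smult emb_adj)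
    then show "c \<cdot>\<^sub>m A \<in> {emb a |a. a \<in> carrier_mat d d}" "adj A \<in> {emb a |a. a \<in> carrier_mat d d}" by auto
  qed
next
  fix A assume "A \<in> {emb a |a. a \<in> carrier_mat d d}"
  then obtain a where a: "a \<in> carrier_mat d d" "A = emb a" by auto
  have "emb a \<in> star_alg N S"
  proof (rule mat_unit_induct[OF a(1)])
    show "emb (0\<^sub>m d d) \<in> star_alg N S" by (simp add: emb_zero zero_in_star_alg)
    show "emb (A + B) \<in> star_alg N S"
      if "A \<in> carrier_mat d d" "B \<in> carrier_mat d d" "emb A \<in> star_alg N S" "emb B \<in> star_alg N S" for A B
      using that by (simp add: emb_add star_alg.add)
    show "emb (c \<cdot>\<^sub>m mat_unit d a b) \<in> star_alg N S" if "a < d" "b < d" for a b c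
      using that S by (simp add: emb_smult emb_mat_unit star_alg.smult star_alg.mult star_alg.adj star_alg.gen)
  qed
  then show "A \<in> star_alg N S" using a by simp
qed

end

lemma (in stabilizer_code) pauli_syndrome_frame:
  assumes ne: "Es \<noteq> []" and Es0: "Es ! 0 = 1\<^sub>m N" and Es: "set Es \<subseteq> pauli_group n"
    and max: "max_correctable N P Es"
  shows "\<exists>\<beta> F V. syndrome_frame n k U \<beta> F V
    \<and> star_alg N ((\<lambda>E. E * P) ` set Es)
      = {tensor_factorization.emb K (syndrome_frame.W n k F V) a |a. a \<in> carrier_mat d d}"
proof -
  define m where "m = length Es"
  have Eu: "unitary_mat N (Es ! i)" if "i < m" for i
    using Es that pauli_group_unitary m_def by (meson nth_mem subsetD)
  note Ec [simp] = unitary_matD(1)[OF Eu]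
  have "\<forall>i<m. \<exists>\<chi>. has_syndrome (Es ! i) \<chi>"
    using Es pauli_has_syndrome m_def by (meson nth_mem subsetD)
  then obtain \<chi> where synd: "\<And>i. i < m \<Longrightarrow> has_syndrome (Es ! i) (\<chi> i)" by metis
  have all: "\<chi> ` {..<m} = chars (n - k)"
    using all_syndromes_occur[OF Es max, of \<chi>] synd m_def by simp
  obtain \<beta> where \<beta>: "bij_betw \<beta> {..<d} (chars (n - k))"
    using ex_bij_betw_nat_finite[OF finite_chars, of "n - k"] by (auto simp: lessThan_atLeast0)
  have "\<exists>i<m. \<chi> i = \<beta> a" if "a < d" for a
  proof -
    have "\<beta> a \<in> \<chi> ` {..<m}" using bij_betwE[OF \<beta>] that all by auto
    then show ?thesis by auto
  qed
  \<comment> \<open>One error is chosen for each character. The remaining ones contribute only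
    multiples of the chosen \<open>F a\<close>, by \<open>same_syndrome\<close>.\<close>
  then obtain r where r: "\<And>a. a < d \<Longrightarrow> r a < m" "\<And>a. a < d \<Longrightarrow> \<chi> (r a) = \<beta> a" by metis
  define F where "F a = Es ! r a * P" for a
  obtain V where V: "V \<in> carrier_mat N K" "adj V * V = 1\<^sub>m K" "P * V = V" using P_isometry by blast
  have inj: "\<beta> a = \<beta> b \<longleftrightarrow> a = b" if "a < d" "b < d" for a b
    using bij_betw_imp_inj_on[OF \<beta>] that by (auto dest: inj_onD)
  interpret syndrome_frame n k U \<beta> F V
  proof unfold_locales
    show "bij_betw \<beta> {..<d} (chars (n - k))" by (rule \<beta>)
    show "F a \<in> carrier_mat N N" if "a < d" for a unfolding F_def using r that by simp
    show "adj (F a) * F b = (if a = b then P else 0\<^sub>m N N)" if ab: "a < d" "b < d" for a b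
    proof (cases "a = b")
      case True
      then show ?thesis unfolding F_def using pauli_norm[OF Eu] r ab by simp
    next
      case False
      then have "\<chi> (r a) \<noteq> \<chi> (r b)" using r inj ab by simp
      then show ?thesis unfolding F_def
        using different_syndromes[OF synd Ec synd Ec] r ab False by simp
    qed
    show "U g * F a = \<beta> a g \<cdot>\<^sub>m F a" if a: "a < d" and g: "g \<in> G" for a g
    proof -
      have "U g * F a = U g * Es ! r a * P" unfolding F_def using r a g by (simp add: assoc_mult_mat[of _ N N _ N _ N])
      also have "U g * Es ! r a = \<beta> a g \<cdot>\<^sub>m (Es ! r a * U g)"
        using synd[OF r(1)[OF a]] r(2)[OF a] g unfolding has_syndrome_def by simp
      also have "\<dots> * P = \<beta> a g \<cdot>\<^sub>m (Es ! r a * (U g * P))"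
        using r a g by (simp add: mult_smult_assoc_mat[of _ N N _ N] assoc_mult_mat[of _ N N _ N _ N])
      finally show ?thesis unfolding F_def using g by (simp add: U_mult_P)
    qed
    show "F a * P = F a" if "a < d" for a
      unfolding F_def using r that by (simp add: assoc_mult_mat[of _ N N _ N _ N] P_square)
  qed (use V in auto)
  have sf: "syndrome_frame n k U \<beta> F V" by unfold_locales
  obtain C where KL: "KL_matrix N P Es C" using max unfolding max_correctable_def by auto
  have "star_alg N ((\<lambda>E. E * P) ` set Es) = {emb a |a. a \<in> carrier_mat d d}"
  proof (rule star_alg_eq)
    show "F a \<in> (\<lambda>E. E * P) ` set Es" if "a < d" for a
      unfolding F_def using r(1)[OF that] m_def by auto
    \<comment> \<open>The identity error is what supplies the code projector as a generator.\<close>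
    have "Es ! 0 \<in> set Es" using ne by auto
    moreover have "P = Es ! 0 * P" unfolding Es0 by simp
    ultimately show "P \<in> (\<lambda>E. E * P) ` set Es" by blast
    fix X assume "X \<in> (\<lambda>E. E * P) ` set Es"
    then obtain j where j: "j < m" "X = Es ! j * P" by (auto simp: in_set_conv_nth m_def)
    have "\<chi> j \<in> \<beta> ` {..<d}" using all j bij_betw_imp_surj_on[OF \<beta>] by auto
    then obtain a where a: "a < d" "\<chi> j = \<beta> a" by auto
    have "adj (Es ! r a * P) * (Es ! j * P) = C $$ (r a, j) \<cdot>\<^sub>m P"
      using KL KL_product[OF Ec Ec] r(1)[OF a(1)] j unfolding KL_matrix_def m_def by auto
    then have "X = C $$ (r a, j) \<cdot>\<^sub>m F a"
      unfolding F_def j(2) using same_syndrome[OF synd Eu _ Ec] r[OF a(1)] a(2) j(1) synd[OF j(1)] by metis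
    then show "\<exists>c. \<exists>a<d. X = c \<cdot>\<^sub>m F a" using a by blast
  qed
  then show ?thesis using sf by blast
qed

theorem mainTheorem1:
  fixes n k :: nat and U :: "bool list \<Rightarrow> complex mat"
  assumes "n \<ge> 1" and "k < n" and "stab_rep n k U"
  shows
  "(\<forall>Es :: complex mat list.
      Es \<noteq> [] \<and> Es ! 0 = 1\<^sub>m (2^n) \<and> set Es \<subseteq> pauli_group n
      \<and> max_correctable (2^n) (proj_pn n k U) Es \<longrightarrow>
      (let P = proj_pn n k U; AR = star_alg (2^n) ((\<lambda>E. E * P) ` set Es) in
        (\<forall>Es'. correctable (2^n) P Es' \<and> err_equiv (2^n) P Es Es' \<longrightarrow>
               star_alg (2^n) ((\<lambda>E. E * P) ` set Es') = AR)
      \<and> U ` Zgrp (n-k) \<subseteq> AR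
      \<and> (\<exists>W UR ket c.
            unitary_mat (2^n) W
          \<and> AR = {W * kron a (1\<^sub>m (2^k)) * adj W | a. a \<in> carrier_mat (2^(n-k)) (2^(n-k))}
          \<and> commutant (2^n) AR = {W * kron (1\<^sub>m (2^(n-k))) b * adj W | b. b \<in> carrier_mat (2^k) (2^k)}
          \<and> (\<forall>B\<in>commutant (2^n) AR. \<forall>g\<in>Zgrp (n-k). B * U g = U g * B)
          \<and> (\<forall>g\<in>Zgrp (n-k). UR g \<in> carrier_mat (2^(n-k)) (2^(n-k))
                 \<and> U g = W * kron (UR g) (1\<^sub>m (2^k)) * adj W)
          \<and> (\<forall>g\<in>Zgrp (n-k). ket g \<in> carrier_vec (2^(n-k)))
          \<and> (\<forall>g\<in>Zgrp (n-k). \<forall>h\<in>Zgrp (n-k). cinner (ket g) (ket h) = (if g = h then 1 else 0))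
          \<and> (\<forall>v\<in>carrier_vec (2^(n-k)). \<exists>a. v = vec (2^(n-k)) (\<lambda>i. \<Sum>g\<in>Zgrp (n-k). a g * ket g $ i))
          \<and> (\<forall>g\<in>Zgrp (n-k). \<forall>h\<in>Zgrp (n-k).
                 UR g *\<^sub>v ket h = c g h \<cdot>\<^sub>v ket (gmul g h) \<and> cmod (c g h) = 1))))
   \<and> (\<forall>W UR. unitary_mat (2^n) W
        \<and> (\<forall>g\<in>Zgrp (n-k). UR g \<in> carrier_mat (2^(n-k)) (2^(n-k))
               \<and> U g = W * kron (UR g) (1\<^sub>m (2^k)) * adj W)
        \<and> inj_on UR (Zgrp (n-k)) \<longrightarrow>
      (let P = proj_pn n k U;
           factor = (\<lambda>E. \<exists>e\<in>carrier_mat (2^(n-k)) (2^(n-k)). E * P = W * kron e (1\<^sub>m (2^k)) * adj W) in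
       \<exists>Es. max_correctable (2^n) P Es
          \<and> (\<forall>Es'. correctable (2^n) P Es' \<and> err_equiv (2^n) P Es Es' \<longrightarrow> (\<forall>E\<in>set Es'. factor E))
          \<and> (\<forall>Es'. max_correctable (2^n) P Es' \<and> (\<forall>E\<in>set Es'. factor E) \<longrightarrow> err_equiv (2^n) P Es Es')
          \<and> (\<forall>Uh \<chi>s. dual_rep (n-k) (2^(n-k)) UR Uh \<and> distinct \<chi>s \<and> set \<chi>s = chars (n-k) \<longrightarrow>
               (let L = map (\<lambda>\<chi>. W * kron (Uh \<chi>) (1\<^sub>m (2^k)) * adj W) \<chi>s in
                max_correctable (2^n) P L \<and> err_equiv (2^n) P Es L))))"
proof (intro conjI allI impI, goal_cases)
  case (1 Es)
  interpret stabilizer_code n k U using assms by unfold_locales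
  have Es: "Es \<noteq> []" "Es ! 0 = 1\<^sub>m (2 ^ n)" "set Es \<subseteq> pauli_group n" "max_correctable (2 ^ n) P Es"
    using 1 by auto
  let ?AR = "star_alg N ((\<lambda>E. E * P) ` set Es)"
  from pauli_syndrome_frame[OF Es] obtain \<beta> F V where sf: "syndrome_frame n k U \<beta> F V"
    and alg: "?AR = {tensor_factorization.emb K (syndrome_frame.W n k F V) a |a. a \<in> carrier_mat d d}"
    by blast
  interpret syndrome_frame n k U \<beta> F V by (rule sf)
  have comm: "commutant N ?AR = {emb' b |b. b \<in> carrier_mat K K}"
    unfolding alg by (rule commutant_emb)
  have G_alg: "U ` G \<subseteq> ?AR"
    unfolding alg using emb_UR[symmetric] UR_carrier by blast
  have indep: "star_alg N ((\<lambda>E. E * P) ` set Es') = ?AR"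
    if "correctable N P Es'" "err_equiv N P Es Es'" for Es'
  proof (rule star_alg_mspan_eq)
    show "(\<lambda>E. E * P) ` set Es' \<subseteq> carrier_mat N N" using that(1) unfolding correctable_def by auto
    show "(\<lambda>E. E * P) ` set Es \<subseteq> carrier_mat N N" using Es(4) unfolding max_correctable_def by auto
  qed (use that(2) in \<open>simp add: err_equiv_def\<close>)
  have gauge: "B * U g = U g * B" if "B \<in> commutant N ?AR" "g \<in> G" for B g
    using that G_alg unfolding commutant_def by auto
  have ketc: "ket g \<in> carrier_vec d" for g unfolding ket_def by simp
  have Ug: "U g = W * kron (UR g) (1\<^sub>m K) * adj W" if "g \<in> G" for g
    using emb_UR[OF that] unfolding emb_def by simp
  show ?case
    unfolding Let_def
  proof (intro conjI, goal_cases)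
    case 1
    show ?case using indep by blast
  next
    case 2
    show ?case by (rule G_alg)
  next
    case 3
    show ?case
      using W_unitary alg[unfolded emb_def] comm[unfolded emb'_def] gauge Ug ketc
        ket_orthonormal ket_complete UR_ket
      by (intro exI[of _ W] exI[of _ UR] exI[of _ ket] exI[of _ "\<lambda>_ _. 1"] conjI ballI) simp_all
  qed
next
  case (2 W UR)
  then interpret reference_frame n k U W UR using assms by unfold_locales auto
  \<comment> \<open>Once the dual set is known to be maximal and admissible, its membership in the
    class follows from uniqueness.\<close>
  have dual: "max_correctable N P (map (\<lambda>\<chi>. emb (Uh \<chi>)) \<chi>s)
      \<and> err_equiv N P basis_errors (map (\<lambda>\<chi>. emb (Uh \<chi>)) \<chi>s)"
    if "dual_rep (n - k) d UR Uh" "distinct \<chi>s" "set \<chi>s = chars (n - k)" for Uh \<chi>s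
    using max_correctable_dual_rep[OF that] factors_dual_rep[OF that(1)] that(3)
    by (auto intro!: err_equiv_basis_errors)
  \<comment> \<open>Existence and uniqueness of the class rest on one fact: every admissible maximal
    set has span \<open>frame_errors\<close>.\<close>
  show ?case
    unfolding Let_def emb_def[symmetric] factors_def[symmetric]
    using max_correctable_basis_errors factors_of_err_equiv err_equiv_basis_errors dual
    by (intro exI[of _ basis_errors]) blast
qed

end
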